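(* Let $\mathcal{T}$ be a T-mesh, let $\mathbf{r}$ be a smoothness distribution on $\mathcal{T}$, let $m,m'\in\mathbb{N}$, and let $\iota$ be an ordering of the maximal interior segments of $\mathcal{T}$ with associated weight $\omega=\omega_\iota$. If $\mathcal{T}$ is $(m+1,m'+1)$-weighted, then $h_{m,m'}^{\mathbf{r}}(\mathcal{T})=0$.
   Context: T-mesh. A T-mesh $\mathcal{T}$ of $\mathbb{R}^2$ consists of a finite set $\mathcal{T}_2$ of closed axis-aligned rectangles (cells), a finite set $\mathcal{T}_1$ of closed axis-aligned segments (edges) contained in $\bigcup_{\sigma\in\mathcal{T}_2}\partial\sigma$, and the finite set $\mathcal{T}_0=\bigcup_{\tau\in\mathcal{T}_1}\partial\tau$ of end points of edges (vertices), such that: for $\sigma\in\mathcal{T}_2$, $\partial\sigma$ is a finite union of elements of $\mathcal{T}_1$; for $\sigma\ne\sigma'$ in $\mathcal{T}_2$, $\sigma\cap\sigma'=\partial\sigma\cap\partial\sigma'$ is a finite union of elements of $\mathcal{T}_1\cup\mathcal{T}_0$; for $\tau\neq\tau'$ in $\mathcal{T}_1$, $\tau\cap\tau'=\partial\tau\cap\partial\tau'\subset\mathcal{T}_0$. The domain is $\Omega=\bigcup_{\sigma\in\mathcal{T}_2}\sigma$, with interior $\Omega^\circ$. Edges parallel to the first axis are horizontal, those parallel to the second axis are vertical. Standing assumptions: every vertex belongs to at least one horizontal edge and at least one vertical edge; $\Omega$ is simply connected and $\Omega^\circ$ is connected. An edge is interior if it meets $\Omega^\circ$; $\mathcal{T}_1^o$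 is the set of interior edges. A vertex is interior if it lies in $\Omega^\circ$; $\mathcal{T}_0^o$ is the set of interior vertices. Smoothness. Use coordinates $(s,t)$ and $0\in\mathbb N$. Let $\nu_h(\mathcal{T})$ be the set of first coordinates of points of vertical edges and $\nu_v(\mathcal{T})$ the set of second coordinates of points of horizontal edges. A smoothness distribution $\mathbf{r}$ is a pair of maps $\mathbf{r}_h:\nu_h(\mathcal{T})\to\mathbb{N}$, $\mathbf{r}_v:\nu_v(\mathcal{T})\to\mathbb{N}$. For a vertical edge $\tau$ on $s=a$, $\mathbf{r}(\tau)=\mathbf{r}_h(a)$; for a horizontal edge $\tau$ on $t=b$, $\mathbf{r}(\tau)=\mathbf{r}_v(b)$. For a vertex $\gamma=(a,b)$, $\mathbf{r}_h(\gamma)=\mathbf{r}_h(a)$, $\mathbf{r}_v(\gamma)=\mathbf{r}_v(b)$. The number $h$. $R_{m,m'}$ is the space of polynomials in $\mathbb{R}[s,t]$ of degree $\le m$ in $s$ and $\le m'$ in $t$. For an edge $\tau$, let $l_\tau$ be a nonzero polynomial of degree 1 defining the line supporting $\tau$, $\Delta^{\mathbf{r}}(\tau)=l_\tau^{\mathbf{r}(\tau)+1}$, and $\mathfrak{I}^{\mathbf{r}}_{m,m'}(\tau)=(\Delta^{\mathbf{r}}(\tau))\cap R_{m,m'}$. For a vertex $\gamma$, $\mathfrak{I}^{\mathbf{r}}_{m,m'}(\gamma)=\mathfrak{I}^{\mathbf{r}}_{m,m'}(\tau_v)+\mathfrak{I}^{\mathbf{r}}_{m,m'}(\tau_h)$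 for any vertical edge $\tau_v$ and horizontal edge $\tau_h$ containing $\gamma$. With a chosen orientation of each edge, let $$\partial_1:\bigoplus_{\tau\in\mathcal{T}_1^o}[\tau]\,\mathfrak{I}^{\mathbf{r}}_{m,m'}(\tau)\to\bigoplus_{\gamma\in\mathcal{T}_0^o}[\gamma]\,\mathfrak{I}^{\mathbf{r}}_{m,m'}(\gamma),\qquad [\tau]p\mapsto[\gamma_2]p-[\gamma_1]p$$ for $\tau$ oriented from $\gamma_1$ to $\gamma_2$, where $[\gamma]=0$ if $\gamma\notin\mathcal{T}_0^o$. Then $h_{m,m'}^{\mathbf{r}}(\mathcal{T})$ is the dimension of the cokernel $H_0(\mathfrak{I}_{m,m'}^{\mathbf{r}}(\mathcal{T}^o))$ of $\partial_1$. Maximal interior segments and weights. For an interior edge $\tau$, the maximal segment $\rho(\tau)$ is the maximal connected union of interior edges of the same direction as $\tau$ that contains $\tau$. It is interior if it does not intersect $\partial\Omega$. $\mathrm{MIS}(\mathcal{T})$, $\mathrm{MIS}_h(\mathcal{T})$, $\mathrm{MIS}_v(\mathcal{T})$ are the sets of all, horizontal, vertical maximal interior segments. An ordering $\iota$ is an injective map $\mathrm{MIS}(\mathcal{T})\to\mathbb{N}$. $\Gamma_\iota(\rho)$ is the set of vertices of $\rho$ which do not lie on a maximal interior segment $\rho'$ with $\iota(\rho')>\iota(\rho)$. The weight of $\rho$ is $\omega_\iota(\rho)=\sum_{\gamma\in\Gamma_\iota(\rho)}(m-\mathbf{r}_h(\gamma))$ if $\rho\in\mathrm{MIS}_h(\mathcal{T})$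 and $\omega_\iota(\rho)=\sum_{\gamma\in\Gamma_\iota(\rho)}(m'-\mathbf{r}_v(\gamma))$ if $\rho\in\mathrm{MIS}_v(\mathcal{T})$. $\mathcal{T}$ (with $\mathbf{r}$ and $\iota$) is $(k,k')$-weighted if $\omega(\rho)\ge k$ for all $\rho\in\mathrm{MIS}_h(\mathcal{T})$ and $\omega(\rho)\ge k'$ for all $\rho\in\mathrm{MIS}_v(\mathcal{T})$. *)

theory Defs
  imports
    "HOL-Analysis.Analysis"
    "HOL-Computational_Algebra.Polynomial"
    "HOL-Library.Poly_Mapping"
begin

section \<open>T-meshes\<close>

type_synonym point = "real \<times> real"

text \<open>Cells and edges are nondegenerate: a cell has nonempty interior, and an edge has two
  distinct end points. The boundary of a cell is its \<^const>\<open>frontier\<close>; the boundary of an edge is its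
  \<^const>\<open>rel_frontier\<close>, that is, the set of its two end points.\<close>

definition is_rectangle :: "point set \<Rightarrow> bool" where
  "is_rectangle \<sigma> \<longleftrightarrow> (\<exists>a b c d. a < c \<and> b < d \<and> \<sigma> = cbox (a, b) (c, d))"

definition horizontal :: "point set \<Rightarrow> bool" where
  "horizontal \<tau> \<longleftrightarrow> (\<exists>a c b. a < c \<and> \<tau> = closed_segment (a, b) (c, b))"

definition vertical :: "point set \<Rightarrow> bool" where
  "vertical \<tau> \<longleftrightarrow> (\<exists>a b d. b < d \<and> \<tau> = closed_segment (a, b) (a, d))"

record mesh =
  cells :: "point set set"
  edges :: "point set set"

definition vertices :: "mesh \<Rightarrow> point set" where
  "vertices T = (\<Union>\<tau>\<in>edges T. rel_frontier \<tau>)"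

definition domain :: "mesh \<Rightarrow> point set" where
  "domain T = \<Union>(cells T)"

definition tmesh :: "mesh \<Rightarrow> bool" where
  "tmesh T \<longleftrightarrow>
     finite (cells T) \<and> (\<forall>\<sigma>\<in>cells T. is_rectangle \<sigma>) \<and>
     finite (edges T) \<and> (\<forall>\<tau>\<in>edges T. horizontal \<tau> \<or> vertical \<tau>) \<and>
     (\<forall>\<tau>\<in>edges T. \<tau> \<subseteq> (\<Union>\<sigma>\<in>cells T. frontier \<sigma>)) \<and>
     (\<forall>\<sigma>\<in>cells T. \<exists>S. finite S \<and> S \<subseteq> edges T \<and> frontier \<sigma> = \<Union>S) \<and>
     (\<forall>\<sigma>\<in>cells T. \<forall>\<sigma>'\<in>cells T. \<sigma> \<noteq> \<sigma>' \<longrightarrow>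
        \<sigma> \<inter> \<sigma>' = frontier \<sigma> \<inter> frontier \<sigma>' \<and>
        (\<exists>S. finite S \<and> S \<subseteq> edges T \<union> (\<lambda>\<gamma>. {\<gamma>}) ` vertices T \<and> \<sigma> \<inter> \<sigma>' = \<Union>S)) \<and>
     (\<forall>\<tau>\<in>edges T. \<forall>\<tau>'\<in>edges T. \<tau> \<noteq> \<tau>' \<longrightarrow>
        \<tau> \<inter> \<tau>' = rel_frontier \<tau> \<inter> rel_frontier \<tau>' \<and> \<tau> \<inter> \<tau>' \<subseteq> vertices T) \<and>
     (\<forall>\<gamma>\<in>vertices T. (\<exists>\<tau>\<in>edges T. horizontal \<tau> \<and> \<gamma> \<in> \<tau>) \<and> (\<exists>\<tau>\<in>edges T. vertical \<tau> \<and> \<gamma> \<in> \<tau>)) \<and>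
     simply_connected (domain T) \<and> connected (interior (domain T))"

definition interior_edges :: "mesh \<Rightarrow> point set set" where
  "interior_edges T = {\<tau> \<in> edges T. \<tau> \<inter> interior (domain T) \<noteq> {}}"

definition interior_vertices :: "mesh \<Rightarrow> point set" where
  "interior_vertices T = vertices T \<inter> interior (domain T)"

section \<open>Smoothness distributions\<close>

text \<open>A pair \<open>(r\<^sub>h, r\<^sub>v)\<close>. The two maps are total functions, but only their values at first
  coordinates of points of vertical edges, respectively at second coordinates of points of
  horizontal edges, are ever used.\<close>

type_synonym smoothness = "(real \<Rightarrow> nat) \<times> (real \<Rightarrow> nat)"

text \<open>\<open>the_elem (fst ` \<tau>)\<close> is the \<open>a\<close> such that the vertical edge \<open>\<tau>\<close> lies on the line \<open>s = a\<close>;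
  similarly for horizontal edges.\<close>

definition edge_smoothness :: "smoothness \<Rightarrow> point set \<Rightarrow> nat" where
  "edge_smoothness r \<tau> =
     (if vertical \<tau> then fst r (the_elem (fst ` \<tau>)) else snd r (the_elem (snd ` \<tau>)))"

section \<open>The polynomial spaces attached to edges and vertices\<close>

text \<open>The ring \<open>\<real>[s, t]\<close> is rendered as \<open>\<real>[s][t]\<close>: the outer variable is \<open>t\<close>, and the
  coefficients are polynomials in \<open>s\<close>.\<close>

type_synonym bipoly = "real poly poly"

definition bidegree_space :: "nat \<Rightarrow> nat \<Rightarrow> bipoly set" where
  "bidegree_space m m' = {p. degree p \<le> m' \<and> (\<forall>j. degree (coeff p j) \<le> m)}"

text \<open>The polynomial \<open>s - a\<close> for a vertical edge on \<open>s = a\<close>, and \<open>t - b\<close> for a horizontal edge on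
  \<open>t = b\<close>. Any other polynomial of degree 1 defining that line is a nonzero scalar multiple and
  generates the same ideals.\<close>

definition line_poly :: "point set \<Rightarrow> bipoly" where
  "line_poly \<tau> =
     (if vertical \<tau> then [:[:- the_elem (fst ` \<tau>), 1:]:] else [:[:- the_elem (snd ` \<tau>):], 1:])"

definition edge_space :: "smoothness \<Rightarrow> nat \<Rightarrow> nat \<Rightarrow> point set \<Rightarrow> bipoly set" where
  "edge_space r m m' \<tau> =
     {p. line_poly \<tau> ^ (edge_smoothness r \<tau> + 1) dvd p} \<inter> bidegree_space m m'"

text \<open>The sum does not depend on the choice of the vertical edge \<open>\<tau>\<^sub>v\<close> and the horizontal edge
  \<open>\<tau>\<^sub>h\<close> through \<open>\<gamma>\<close>, since these only enter through their supporting lines.\<close>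

definition vertex_space :: "mesh \<Rightarrow> smoothness \<Rightarrow> nat \<Rightarrow> nat \<Rightarrow> point \<Rightarrow> bipoly set" where
  "vertex_space T r m m' \<gamma> =
     {p + q | p q \<tau>\<^sub>v \<tau>\<^sub>h.
        \<tau>\<^sub>v \<in> edges T \<and> vertical \<tau>\<^sub>v \<and> \<gamma> \<in> \<tau>\<^sub>v \<and> p \<in> edge_space r m m' \<tau>\<^sub>v \<and>
        \<tau>\<^sub>h \<in> edges T \<and> horizontal \<tau>\<^sub>h \<and> \<gamma> \<in> \<tau>\<^sub>h \<and> q \<in> edge_space r m m' \<tau>\<^sub>h}"

section \<open>The complex and the number h\<close>

text \<open>Elements of the direct sums are finitely supported functions, and \<open>[x] p\<close> is
  \<open>Poly_Mapping.single x p\<close>.\<close>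

definition chains1 :: "mesh \<Rightarrow> smoothness \<Rightarrow> nat \<Rightarrow> nat \<Rightarrow> (point set \<Rightarrow>\<^sub>0 bipoly) set" where
  "chains1 T r m m' =
     {c. Poly_Mapping.keys c \<subseteq> interior_edges T \<and>
         (\<forall>\<tau>\<in>interior_edges T. Poly_Mapping.lookup c \<tau> \<in> edge_space r m m' \<tau>)}"

definition chains0 :: "mesh \<Rightarrow> smoothness \<Rightarrow> nat \<Rightarrow> nat \<Rightarrow> (point \<Rightarrow>\<^sub>0 bipoly) set" where
  "chains0 T r m m' =
     {c. Poly_Mapping.keys c \<subseteq> interior_vertices T \<and>
         (\<forall>\<gamma>\<in>interior_vertices T. Poly_Mapping.lookup c \<gamma> \<in> vertex_space T r m m' \<gamma>)}"

text \<open>An orientation \<open>d\<close> orients the edge \<open>\<tau>\<close> from \<open>fst (d \<tau>)\<close> to \<open>snd (d \<tau>)\<close>. An edge has two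
  distinct end points, so \<open>fst (d \<tau>) \<noteq> snd (d \<tau>)\<close>.\<close>

definition orientation :: "mesh \<Rightarrow> (point set \<Rightarrow> point \<times> point) \<Rightarrow> bool" where
  "orientation T d \<longleftrightarrow> (\<forall>\<tau>\<in>edges T. rel_frontier \<tau> = {fst (d \<tau>), snd (d \<tau>)})"

definition vertex_term :: "mesh \<Rightarrow> point \<Rightarrow> bipoly \<Rightarrow> (point \<Rightarrow>\<^sub>0 bipoly)" where
  "vertex_term T \<gamma> p = (if \<gamma> \<in> interior_vertices T then Poly_Mapping.single \<gamma> p else 0)"

definition boundary1 ::
    "mesh \<Rightarrow> (point set \<Rightarrow> point \<times> point) \<Rightarrow> (point set \<Rightarrow>\<^sub>0 bipoly) \<Rightarrow> (point \<Rightarrow>\<^sub>0 bipoly)" where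
  "boundary1 T d c =
     (\<Sum>\<tau>\<in>Poly_Mapping.keys c.
        vertex_term T (snd (d \<tau>)) (Poly_Mapping.lookup c \<tau>) -
        vertex_term T (fst (d \<tau>)) (Poly_Mapping.lookup c \<tau>))"

text \<open>The dimension of \<open>V / W\<close>, for subspaces \<open>W \<subseteq> V\<close>, is the number of elements of a basis of
  \<open>V / W\<close>. A basis is given by a set \<open>B\<close> of representatives in \<open>V\<close>; the second condition says that
  their classes are distinct and linearly independent, the third that they span \<open>V / W\<close>. As for
  \<open>dim\<close>, the value is only meaningful if this dimension is finite.\<close>

definition (in vector_space) quotient_basis :: "'b set \<Rightarrow> 'b set \<Rightarrow> 'b set \<Rightarrow> bool" where
  "quotient_basis V W B \<longleftrightarrow>
     B \<subseteq> V \<and>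
     (\<forall>S u. finite S \<and> S \<subseteq> B \<and> (\<Sum>v\<in>S. scale (u v) v) \<in> W \<longrightarrow> (\<forall>v\<in>S. u v = 0)) \<and>
     V \<subseteq> span (W \<union> B)"

definition (in vector_space) quotient_dim :: "'b set \<Rightarrow> 'b set \<Rightarrow> nat" where
  "quotient_dim V W = card (SOME B. quotient_basis V W B)"

definition chain_scale :: "real \<Rightarrow> (point \<Rightarrow>\<^sub>0 bipoly) \<Rightarrow> (point \<Rightarrow>\<^sub>0 bipoly)" where
  "chain_scale a = Poly_Mapping.map (smult [:a:])"

lemma lookup_chain_scale:
  "Poly_Mapping.lookup (chain_scale a c) \<gamma> = smult [:a:] (Poly_Mapping.lookup c \<gamma>)"
  by (simp add: chain_scale_def Poly_Mapping.map.rep_eq when_def)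

global_interpretation chain: vector_space chain_scale
  by unfold_locales
     (auto intro!: poly_mapping_eqI
       simp: lookup_chain_scale lookup_add smult_add_right mult.commute
       simp flip: one_pCons smult_add_left)

definition h_number ::
    "mesh \<Rightarrow> smoothness \<Rightarrow> nat \<Rightarrow> nat \<Rightarrow> (point set \<Rightarrow> point \<times> point) \<Rightarrow> nat" where
  "h_number T r m m' d =
     chain.quotient_dim (chains0 T r m m') (boundary1 T d ` chains1 T r m m')"

section \<open>Maximal interior segments and weights\<close>

text \<open>The union of all connected unions of interior edges that have the direction of \<open>\<tau>\<close> and
  contain \<open>\<tau>\<close>; as these all contain \<open>\<tau>\<close>, it is itself the largest one of them.\<close>

definition maximal_segment :: "mesh \<Rightarrow> point set \<Rightarrow> point set" where
  "maximal_segment T \<tau> =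
     \<Union>{\<Union>S | S. S \<subseteq> {\<tau>' \<in> interior_edges T. horizontal \<tau>' \<longleftrightarrow> horizontal \<tau>} \<and>
               \<tau> \<subseteq> \<Union>S \<and> connected (\<Union>S)}"

definition MIS_h :: "mesh \<Rightarrow> point set set" where
  "MIS_h T = {maximal_segment T \<tau> | \<tau>. \<tau> \<in> interior_edges T \<and> horizontal \<tau> \<and>
                maximal_segment T \<tau> \<inter> frontier (domain T) = {}}"

definition MIS_v :: "mesh \<Rightarrow> point set set" where
  "MIS_v T = {maximal_segment T \<tau> | \<tau>. \<tau> \<in> interior_edges T \<and> vertical \<tau> \<and>
                maximal_segment T \<tau> \<inter> frontier (domain T) = {}}"

definition MIS :: "mesh \<Rightarrow> point set set" where
  "MIS T = MIS_h T \<union> MIS_v T"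

definition free_vertices :: "mesh \<Rightarrow> (point set \<Rightarrow> nat) \<Rightarrow> point set \<Rightarrow> point set" where
  "free_vertices T \<iota> \<rho> =
     {\<gamma> \<in> vertices T \<inter> \<rho>. \<not> (\<exists>\<rho>'\<in>MIS T. \<iota> \<rho>' > \<iota> \<rho> \<and> \<gamma> \<in> \<rho>')}"

text \<open>The summands are integers and may be negative.\<close>

definition weight ::
    "mesh \<Rightarrow> smoothness \<Rightarrow> nat \<Rightarrow> nat \<Rightarrow> (point set \<Rightarrow> nat) \<Rightarrow> point set \<Rightarrow> int" where
  "weight T r m m' \<iota> \<rho> =
     (if \<rho> \<in> MIS_h T
      then \<Sum>\<gamma>\<in>free_vertices T \<iota> \<rho>. int m - int (fst r (fst \<gamma>))
      else \<Sum>\<gamma>\<in>free_vertices T \<iota> \<rho>. int m' - int (snd r (snd \<gamma>)))"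

definition weighted ::
    "nat \<Rightarrow> nat \<Rightarrow> mesh \<Rightarrow> smoothness \<Rightarrow> nat \<Rightarrow> nat \<Rightarrow> (point set \<Rightarrow> nat) \<Rightarrow> bool" where
  "weighted k k' T r m m' \<iota> \<longleftrightarrow>
     (\<forall>\<rho>\<in>MIS_h T. weight T r m m' \<iota> \<rho> \<ge> int k) \<and>
     (\<forall>\<rho>\<in>MIS_v T. weight T r m m' \<iota> \<rho> \<ge> int k')"

end

theory Submission
  imports Defs
begin

text \<open>The number is \<open>0\<close> because the boundary map is onto. Modulo boundaries,
  \<open>[\<gamma>] p\<close> does not depend on the vertex \<open>\<gamma>\<close> of a maximal segment \<open>\<rho>\<close>, for \<open>p\<close> in the space attached to \<open>\<rho>\<close>, and it vanishes if \<open>\<rho>\<close>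
  reaches the boundary of the domain. For an interior \<open>\<rho>\<close> one proceeds by induction on the ordering:
  each free vertex \<open>\<gamma>\<close> lies on a transversal segment that is either not interior or comes earlier, so
  \<open>[\<gamma>] q\<close> vanishes for all \<open>q\<close> in the intersection of the spaces of both segments. The weight
  condition ensures that these intersections span the space of \<open>\<rho>\<close>. This reduces to one
  variable: for distinct \<open>a\<^sub>i\<close>, the multiples of the \<open>(x - a\<^sub>i) ^ e\<^sub>i\<close> of degree at most \<open>m\<close>
  span all polynomials of degree at most \<open>m\<close> as soon as \<open>\<Sum>\<^sub>i (m + 1 - e\<^sub>i)\<^sup>+ \<ge> m + 1\<close>.\<close>

section \<open>Sums of multiples of powers of linear polynomials\<close>

text \<open>Homogenizing polynomials of degree at most \<open>m\<close>, this is the derivative in the direction on which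
  \<open>x - b\<close> vanishes. It lowers the degree bound \<open>m\<close> by one, lowers the exponent of every factor
  \<open>x - a\<close> with \<open>a \<noteq> b\<close> by one, and keeps that of \<open>x - b\<close>; this drives the induction on \<open>m\<close> below.\<close>

definition euler_op :: "nat \<Rightarrow> real \<Rightarrow> real poly \<Rightarrow> real poly" where
  "euler_op m b h = smult (real m) h - [:- b, 1:] * pderiv h"

lemma euler_op_add: "euler_op m b (f + g) = euler_op m b f + euler_op m b g"
  and euler_op_diff: "euler_op m b (f - g) = euler_op m b f - euler_op m b g"
  and euler_op_smult: "euler_op m b (smult c f) = smult c (euler_op m b f)"
  and euler_op_0: "euler_op m b 0 = 0"
  by (simp_all add: euler_op_def algebra_simps pderiv_add pderiv_diff pderiv_smult smult_add_right
      smult_diff_right)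

lemma euler_op_sum: "euler_op m b (sum f I) = (\<Sum>i\<in>I. euler_op m b (f i))"
  by (induction I rule: infinite_finite_induct) (simp_all add: euler_op_0 euler_op_add)

text \<open>In degree \<open>Suc m\<close> the terms of \<open>smult (Suc m) h\<close> and of
  \<open>x * pderiv h\<close> cancel, and nothing higher occurs.\<close>

lemma degree_euler_op:
  assumes "degree h \<le> Suc m"
  shows "degree (euler_op (Suc m) b h) \<le> m"
proof (rule degree_le, intro allI impI)
  fix i assume i: "i > m"
  then have z: "coeff h (Suc i) = 0" using assms by (simp add: coeff_eq_0)
  obtain k where k: "i = Suc k" using i by (cases i) auto
  have "coeff h i = 0" if "i \<noteq> Suc m" using that i assms by (simp add: coeff_eq_0)
  then show "coeff (euler_op (Suc m) b h) i = 0"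
    using z i k by (cases "i = Suc m") (auto simp: euler_op_def coeff_pderiv coeff_pCons)
qed

text \<open>Write \<open>x - b\<close> as \<open>(x - a) - (b - a)\<close>. For
  \<open>a \<noteq> b\<close> the second term shows that the exponent falls by exactly one; for
  \<open>a = b\<close> it disappears, and the powers of \<open>x - b\<close> are
  eigenvectors.\<close>

lemma euler_op_power:
  "euler_op m b ([:- a, 1:] ^ Suc k) =
     smult (real m - real (Suc k)) ([:- a, 1:] ^ Suc k) + smult (real (Suc k) * (b - a)) ([:- a, 1:] ^ k)"
proof -
  have b: "[:- b, 1:] = [:- a, 1:] - [:b - a:]" by simp
  have *: "smult M (l * P) - (l - [:c:]) * smult K P = smult (M - K) (l * P) + smult (K * c) P"
    for M K c and l P :: "real poly"
    by (simp add: algebra_simps smult_diff_left)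
  have "pderiv ([:- a, 1:] ^ Suc k) = smult (real (Suc k)) ([:- a, 1:] ^ k)"
    by (simp add: pderiv_power_Suc pderiv_pCons del: power_Suc)
  then show ?thesis
    unfolding euler_op_def b by (simp only: power_Suc *)
qed

lemma euler_op_power_self:
  "euler_op m b ([:- b, 1:] ^ k) = smult (real m - real k) ([:- b, 1:] ^ k)"
proof (cases k)
  case 0
  then show ?thesis by (simp add: euler_op_def)
next
  case (Suc j)
  then show ?thesis using euler_op_power[of m b b j] by simp
qed

text \<open>The equation reads \<open>(x - b) * pderiv u = m * u\<close>. With
  \<open>u = (x - b) ^ k * w\<close> it becomes \<open>(m - k) * w = (x - b) * pderiv w\<close>, so
  another factor \<open>x - b\<close> splits off as long as \<open>k < m\<close>.\<close>

lemma euler_op_kernel: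
  assumes "euler_op m b u = 0" "k \<le> m"
  shows "[:- b, 1:] ^ k dvd u"
  using assms(2)
proof (induction k)
  case (Suc k)
  then obtain w where w: "u = [:- b, 1:] ^ k * w" by (auto elim: dvdE)
  let ?l = "[:- b, 1:]"
  have "?l * pderiv u = smult (real k) (?l ^ k * w) + ?l ^ k * (?l * pderiv w)"
  proof (cases k)
    case (Suc j)
    have "pderiv (?l ^ Suc j) = smult (real (Suc j)) (?l ^ j)"
      by (simp add: pderiv_power_Suc pderiv_pCons del: power_Suc)
    moreover have "l * (l * P * x + w * smult M P) = smult M (l * P * w) + l * P * (l * x)"
      for l P x w :: "real poly" and M
      by (simp add: algebra_simps)
    ultimately show ?thesis
      unfolding w Suc pderiv_mult by (simp only: power_Suc)
  qed (simp add: w)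
  moreover have "smult (real m) u = ?l * pderiv u"
    using assms(1) by (simp only: euler_op_def right_minus_eq)
  ultimately have "?l ^ k * (smult (real m - real k) w - ?l * pderiv w) = 0"
    unfolding w by (simp only: right_diff_distrib smult_diff_left mult_smult_right)
  then have "smult (real m - real k) w = ?l * pderiv w"
    by (simp only: mult_eq_0_iff power_eq_0_iff pCons_eq_0_iff right_minus_eq) simp
  then have "?l dvd smult (real m - real k) w" by (metis dvd_triv_left)
  then have "?l dvd w" using Suc.prems by (simp add: dvd_smult_iff)
  then show ?case unfolding w power_Suc2 by (intro mult_dvd_mono dvd_refl)
qed simp

text \<open>Successive approximation at \<open>a\<close>: \<open>F k\<close> is a preimage of
  \<open>(x - a) ^ k\<close> up to higher order. Subtracting the image of a multiple of
  \<open>F e\<close> raises the order of \<open>g\<close> at \<open>a\<close>, until it exceeds the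
  degree bound. The divisor \<open>D\<close> is merely inherited from the
  \<open>F k\<close>.\<close>

lemma euler_op_lift:
  assumes F: "\<And>k. e \<le> k \<Longrightarrow> k \<le> m \<Longrightarrow>
      degree (F k) \<le> Suc m \<and> D dvd F k \<and> [:- a, 1:] ^ Suc k dvd euler_op (Suc m) b (F k) - [:- a, 1:] ^ k"
    and "degree g \<le> m" "[:- a, 1:] ^ e dvd g"
  shows "\<exists>h. degree h \<le> Suc m \<and> D dvd h \<and> euler_op (Suc m) b h = g"
  using assms
proof (induction "Suc m - e" arbitrary: e g)
  case 0
  \<comment> \<open>Here \<open>e > m\<close>, so a nonzero multiple of \<open>(x - a) ^ e\<close>
    would have too large a degree.\<close>
  have "g = 0"
  proof (rule ccontr)
    assume "g \<noteq> 0"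
    then have "degree ([:- a, 1:] ^ e) \<le> degree g" using 0 by (intro dvd_imp_degree_le)
    then show False using 0 by (simp add: degree_linear_power)
  qed
  then show ?case by (intro exI[of _ 0]) (simp add: euler_op_0)
next
  case (Suc n)
  let ?l = "[:- a, 1:]"
  have em: "e \<le> m" using Suc.hyps by simp
  from Suc.prems(3) obtain q where q: "g = ?l ^ e * q" by (auto elim: dvdE)
  \<comment> \<open>The coefficient of \<open>(x - a) ^ e\<close> in the Taylor expansion of
    \<open>g\<close> at \<open>a\<close>.\<close>
  define c where "c = poly q a"
  have "?l dvd q - [:c:]" by (simp add: c_def poly_eq_0_iff_dvd [symmetric])
  then have "?l ^ Suc e dvd ?l ^ e * (q - [:c:])"
    unfolding power_Suc2 by (intro mult_dvd_mono dvd_refl)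
  moreover have "?l ^ e * (q - [:c:]) = g - smult c (?l ^ e)"
    unfolding q right_diff_distrib by simp
  ultimately have 1: "?l ^ Suc e dvd g - smult c (?l ^ e)" by simp
  let ?g = "g - euler_op (Suc m) b (smult c (F e))"
  have Fe: "degree (F e) \<le> Suc m" "D dvd F e" "?l ^ Suc e dvd euler_op (Suc m) b (F e) - ?l ^ e"
    using Suc.prems(1)[of e] em by auto
  have "?g = (g - smult c (?l ^ e)) - smult c (euler_op (Suc m) b (F e) - ?l ^ e)"
    by (simp add: euler_op_smult smult_diff_right)
  then have d: "?l ^ Suc e dvd ?g" using 1 Fe(3) by (metis dvd_diff dvd_smult)
  have dc: "degree (smult c (F e)) \<le> Suc m" using Fe(1) degree_smult_le le_trans by blast
  have "degree ?g \<le> m" using Suc.prems(2) degree_euler_op[OF dc] by (intro degree_diff_le) auto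
  then obtain h where h: "degree h \<le> Suc m" "D dvd h" "euler_op (Suc m) b h = ?g"
    using Suc.hyps(1)[OF _ _ _ d] Suc.hyps(2) Suc.prems(1) em by fastforce
  show ?case
    using h Fe dc by (intro exI[of _ "h + smult c (F e)"] conjI degree_add_le dvd_add dvd_smult) (simp_all add: euler_op_add)
qed

lemma euler_op_lift_other:
  assumes "a \<noteq> b" "degree g \<le> m" "[:- a, 1:] ^ e dvd g"
  shows "\<exists>h. degree h \<le> Suc m \<and> [:- a, 1:] ^ Suc e dvd h \<and> euler_op (Suc m) b h = g"
proof (rule euler_op_lift[OF _ assms(2,3)])
  fix k assume k: "e \<le> k" "k \<le> m"
  let ?c = "real (Suc k) * (b - a)"
  \<comment> \<open>By \<open>euler_op_power\<close>, the factor \<open>1 / ?c\<close> normalizes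
    the lowest term of the image to \<open>(x - a) ^ k\<close>; the rest is a multiple of the next
    power.\<close>
  let ?F = "smult (1 / ?c) ([:- a, 1:] ^ Suc k)"
  have c: "?c \<noteq> 0" using assms(1) by simp
  have "euler_op (Suc m) b ?F - [:- a, 1:] ^ k
      = smult (1 / ?c * (real (Suc m) - real (Suc k))) ([:- a, 1:] ^ Suc k)"
    unfolding euler_op_smult euler_op_power smult_add_right smult_smult using c by simp
  moreover have "degree ?F \<le> Suc m" using k c by (simp add: degree_linear_power del: power_Suc)
  ultimately show "degree ?F \<le> Suc m \<and> [:- a, 1:] ^ Suc e dvd ?F \<and>
      [:- a, 1:] ^ Suc k dvd euler_op (Suc m) b ?F - [:- a, 1:] ^ k"
    using k by (auto intro!: dvd_smult le_imp_power_dvd simp del: power_Suc)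
qed

lemma euler_op_lift_self:
  assumes "degree g \<le> m" "[:- b, 1:] ^ e dvd g"
  shows "\<exists>h. degree h \<le> Suc m \<and> [:- b, 1:] ^ e dvd h \<and> euler_op (Suc m) b h = g"
proof (rule euler_op_lift[OF _ assms])
  fix k assume k: "e \<le> k" "k \<le> m"
  \<comment> \<open>An exact preimage: \<open>(x - b) ^ k\<close> is an eigenvector, with nonzero
    eigenvalue because \<open>k \<le> m\<close>.\<close>
  let ?F = "smult (1 / (real (Suc m) - real k)) ([:- b, 1:] ^ k)"
  have "euler_op (Suc m) b ?F = [:- b, 1:] ^ k"
    unfolding euler_op_smult euler_op_power_self smult_smult using k by simp
  moreover have "degree ?F \<le> Suc m" using k by (simp add: degree_linear_power)
  ultimately show "degree ?F \<le> Suc m \<and> [:- b, 1:] ^ e dvd ?F \<and>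
      [:- b, 1:] ^ Suc k dvd euler_op (Suc m) b ?F - [:- b, 1:] ^ k"
    using k by (auto intro!: dvd_smult le_imp_power_dvd)
qed

text \<open>If all exponents are positive, apply \<open>euler_op\<close> with \<open>b = a j\<close>
  for some \<open>j\<close> whose summand in the count is positive. The induction hypothesis splits
  the image of \<open>f\<close>, the pieces lift one by one, and the remaining error lies in the
  kernel, so that the piece of index \<open>j\<close> can absorb it.\<close>

lemma sum_of_linear_powers:
  fixes a :: "'i \<Rightarrow> real" and e :: "'i \<Rightarrow> nat"
  assumes "finite I" "inj_on a I" "m < (\<Sum>i\<in>I. m + 1 - e i)" "degree f \<le> m"
  shows "\<exists>g. (\<forall>i\<in>I. degree (g i) \<le> m \<and> [:- a i, 1:] ^ e i dvd g i) \<and> f = sum g I"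
  using assms(3,4)
proof (induction m arbitrary: e f)
  case 0
  have "\<exists>j\<in>I. e j = 0"
  proof (rule ccontr)
    assume "\<not> ?thesis"
    then have "(\<Sum>i\<in>I. 0 + 1 - e i) = 0" by (intro sum.neutral) auto
    then show False using 0 by simp
  qed
  then obtain j where j: "j \<in> I" "e j = 0" by blast
  then show ?case using 0 assms(1)
    by (intro exI[of _ "\<lambda>i. if i = j then f else 0"]) auto
next
  case (Suc m)
  show ?case
  proof (cases "\<exists>j\<in>I. e j = 0")
    case True
    then obtain j where j: "j \<in> I" "e j = 0" by blast
    then show ?thesis using Suc.prems assms(1)
      by (intro exI[of _ "\<lambda>i. if i = j then f else 0"]) auto
  next
    case False
    have "\<not> (\<forall>j\<in>I. Suc m + 1 - e j = 0)"
      using Suc.prems(1) sum.neutral[of I "\<lambda>i. Suc m + 1 - e i"] by linarith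
    then obtain j where j: "j \<in> I" "Suc m + 1 - e j \<noteq> 0" by blast
    \<comment> \<open>The exponents after applying the operator. For \<open>i \<noteq> j\<close> the
      degree bound and the positive exponent both fall by one, which leaves the summand unchanged;
      the summand of \<open>j\<close> is positive and falls by one. So the strict inequality
      survives.\<close>
    define e' where "e' = (\<lambda>i. if i = j then e j else e i - 1)"
    have "(\<Sum>i\<in>I. Suc m + 1 - e i) = (Suc m + 1 - e j) + (\<Sum>i\<in>I - {j}. Suc m + 1 - e i)"
      using assms(1) j(1) by (simp add: sum.remove)
    also have "\<dots> = Suc ((m + 1 - e' j) + (\<Sum>i\<in>I - {j}. m + 1 - e' i))"
    proof -
      have "(\<Sum>i\<in>I - {j}. Suc m + 1 - e i) = (\<Sum>i\<in>I - {j}. m + 1 - e' i)"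
        using False by (intro sum.cong) (auto simp: e'_def)
      then show ?thesis using j(2) by (simp add: e'_def)
    qed
    also have "\<dots> = Suc (\<Sum>i\<in>I. m + 1 - e' i)"
      using assms(1) j(1) by (simp add: sum.remove)
    finally have "m < (\<Sum>i\<in>I. m + 1 - e' i)" using Suc.prems(1) by simp
    from Suc.IH[OF this degree_euler_op[OF Suc.prems(2), of "a j"]]
    obtain g where g: "\<And>i. i \<in> I \<Longrightarrow> degree (g i) \<le> m \<and> [:- a i, 1:] ^ e' i dvd g i"
        and Lf: "euler_op (Suc m) (a j) f = sum g I" by blast
    have "\<exists>h. degree h \<le> Suc m \<and> [:- a i, 1:] ^ e i dvd h \<and> euler_op (Suc m) (a j) h = g i"
      if i: "i \<in> I" for i
    proof (cases "i = j")
      case True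
      then show ?thesis using g[OF i] euler_op_lift_self[of "g i" m "a j" "e j"] by (simp add: e'_def)
    next
      case ne: False
      then have "a i \<noteq> a j" using assms(2) i j(1) by (auto dest: inj_onD)
      moreover have "Suc (e' i) = e i" using ne False i by (auto simp: e'_def)
      ultimately show ?thesis using g[OF i] euler_op_lift_other[of "a i" "a j" "g i" m "e' i"] by simp
    qed
    then obtain h where h: "\<And>i. i \<in> I \<Longrightarrow> degree (h i) \<le> Suc m \<and> [:- a i, 1:] ^ e i dvd h i \<and>
        euler_op (Suc m) (a j) (h i) = g i" by metis
    \<comment> \<open>The error of the lifted decomposition; it is killed by the operator, hence
      divisible by \<open>(x - a j) ^ e j\<close>.\<close>
    define u where "u = f - sum h I"
    have "euler_op (Suc m) (a j) u = 0"
      using h by (simp add: u_def euler_op_diff euler_op_sum Lf)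
    then have "[:- a j, 1:] ^ e j dvd u" using j(2) by (intro euler_op_kernel) auto
    moreover have "degree u \<le> Suc m"
      unfolding u_def using Suc.prems(2) h assms(1) by (intro degree_diff_le degree_sum_le) auto
    ultimately have "\<forall>i\<in>I. degree (h i + (if i = j then u else 0)) \<le> Suc m \<and>
        [:- a i, 1:] ^ e i dvd h i + (if i = j then u else 0)"
      using h by (simp add: degree_add_le dvd_add)
    moreover have "f = (\<Sum>i\<in>I. h i + (if i = j then u else 0))"
      using assms(1) j(1) by (simp add: sum.distrib u_def)
    ultimately show ?thesis by (intro exI[of _ "\<lambda>i. h i + (if i = j then u else 0)"]) blast
  qed
qed

section \<open>Decompositions in two variables\<close>

lemma map_poly_mult_linear_power:
  fixes F :: "'a::comm_ring_1 \<Rightarrow> 'b::comm_ring_1"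
  assumes add: "\<And>x y. F (x + y) = F x + F y" and mult: "\<And>x. F (u * x) = v * F x"
  shows "map_poly F ([:u, 1:] ^ k * q) = [:v, 1:] ^ k * map_poly F q"
proof (induction k)
  case (Suc k)
  have 0: "F 0 = 0" using add[of 0 0] by simp
  have "map_poly F ([:u, 1:] * q) = [:v, 1:] * map_poly F q" for q
  proof (rule poly_eqI)
    fix n show "coeff (map_poly F ([:u, 1:] * q)) n = coeff ([:v, 1:] * map_poly F q) n"
      by (cases n) (simp_all add: coeff_map_poly 0 add mult)
  qed
  then show ?case using Suc.IH by (simp only: power_Suc mult.assoc)
qed simp

lemma smult_sum_right: "smult c (sum f I) = (\<Sum>i\<in>I. smult c (f i))"
  by (induction I rule: infinite_finite_induct) (simp_all add: smult_add_right)

text \<open>Decompositions are not unique. Fixing one for each monomial yields a decomposition that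
  is linear, so that it extends to polynomials in two variables.\<close>

lemma monom_as_sum_of_linear_powers:
  fixes a :: "'i \<Rightarrow> real" and e :: "'i \<Rightarrow> nat"
  assumes "finite I" "inj_on a I" "m < (\<Sum>i\<in>I. m + 1 - e i)"
  obtains G where "\<And>j i. j \<le> m \<Longrightarrow> i \<in> I \<Longrightarrow> degree (G j i) \<le> m \<and> [:- a i, 1:] ^ e i dvd G j i"
    and "\<And>j. j \<le> m \<Longrightarrow> monom 1 j = sum (G j) I"
proof -
  have "\<forall>j. \<exists>g. j \<le> m \<longrightarrow> (\<forall>i\<in>I. degree (g i) \<le> m \<and> [:- a i, 1:] ^ e i dvd g i) \<and> monom 1 j = sum g I"
    using sum_of_linear_powers[OF assms] by (metis degree_monom_le le_trans)
  then show ?thesis using that by metis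
qed

lemma bipoly_sum_of_linear_powers_s:
  fixes a :: "'i \<Rightarrow> real" and e :: "'i \<Rightarrow> nat"
  assumes I: "finite I" "inj_on a I" "m < (\<Sum>i\<in>I. m + 1 - e i)"
    and p: "p \<in> bidegree_space m m'" "[:[:- b:], 1:] ^ k dvd p"
  shows "\<exists>g. (\<forall>i\<in>I. g i \<in> bidegree_space m m' \<and> [:[:- b:], 1:] ^ k dvd g i \<and>
                [:[:- a i, 1:]:] ^ e i dvd g i) \<and> p = sum g I"
proof -
  obtain G where G: "\<And>j i. j \<le> m \<Longrightarrow> i \<in> I \<Longrightarrow> degree (G j i) \<le> m \<and> [:- a i, 1:] ^ e i dvd G j i"
    and Gsum: "\<And>j. j \<le> m \<Longrightarrow> monom 1 j = sum (G j) I"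
    using monom_as_sum_of_linear_powers[OF I] by blast
  \<comment> \<open>The piece of index \<open>i\<close> in the linear decomposition of a polynomial
    in \<open>s\<close>. Applied to each coefficient of \<open>p\<close>, it does not interfere with
    the variable \<open>t\<close>.\<close>
  define L where "L = (\<lambda>i f. \<Sum>j\<le>m. smult (coeff f j) (G j i))"
  have L_add: "L i (f + g) = L i f + L i g" for i f g
    by (simp add: L_def smult_add_left sum.distrib)
  have L_mult: "L i ([:c:] * f) = [:c:] * L i f" for i c f
    by (simp add: L_def smult_sum_right)
  have L_0: "L i 0 = 0" for i by (simp add: L_def)
  have L_deg: "degree (L i f) \<le> m" and L_dvd: "[:- a i, 1:] ^ e i dvd L i f" if "i \<in> I" for i f
    unfolding L_def using G that
    by (auto intro!: degree_sum_le dvd_sum dvd_smult order.trans[OF degree_smult_le])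
  have L_sum: "(\<Sum>i\<in>I. L i f) = f" if "degree f \<le> m" for f
  proof -
    have "(\<Sum>i\<in>I. L i f) = (\<Sum>j\<le>m. smult (coeff f j) (sum (G j) I))"
      unfolding L_def smult_sum_right by (rule sum.swap)
    also have "\<dots> = (\<Sum>j\<le>m. monom (coeff f j) j)"
      by (intro sum.cong) (simp_all add: Gsum [symmetric] smult_monom)
    finally show ?thesis using that by (simp add: poly_as_sum_of_monoms')
  qed
  define g where "g = (\<lambda>i. map_poly (L i) p)"
  have cg: "coeff (g i) n = L i (coeff p n)" for i n
    by (simp add: g_def coeff_map_poly L_0)
  have "p = sum g I"
    using p(1) by (intro poly_eqI) (simp add: coeff_sum cg L_sum bidegree_space_def)
  moreover have "g i \<in> bidegree_space m m'" if "i \<in> I" for i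
    using that p(1)
    by (auto simp: bidegree_space_def cg L_deg L_0 coeff_eq_0 intro!: degree_le)
  moreover have "[:[:- b:], 1:] ^ k dvd g i" for i
  proof -
    obtain q where "p = [:[:- b:], 1:] ^ k * q" using p(2) by (rule dvdE)
    \<comment> \<open>\<open>L i\<close> is additive and commutes with multiplication by the
      constant \<open>- b\<close>, so the factor in \<open>t\<close> passes through.\<close>
    then have "g i = [:[:- b:], 1:] ^ k * map_poly (L i) q"
      unfolding g_def by (simp only: map_poly_mult_linear_power[of "L i", OF L_add L_mult])
    then show ?thesis by simp
  qed
  moreover have "[:[:- a i, 1:]:] ^ e i dvd g i" if "i \<in> I" for i
    using L_dvd[OF that] by (simp add: poly_const_pow const_poly_dvd_iff cg)
  ultimately show ?thesis by blast
qed

lemma bipoly_sum_of_linear_powers_t: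
  fixes b :: "'i \<Rightarrow> real" and e :: "'i \<Rightarrow> nat"
  assumes I: "finite I" "inj_on b I" "m' < (\<Sum>i\<in>I. m' + 1 - e i)"
    and p: "p \<in> bidegree_space m m'" "[:[:- a, 1:]:] ^ k dvd p"
  shows "\<exists>g. (\<forall>i\<in>I. g i \<in> bidegree_space m m' \<and> [:[:- a, 1:]:] ^ k dvd g i \<and>
                [:[:- b i:], 1:] ^ e i dvd g i) \<and> p = sum g I"
proof -
  obtain G where G: "\<And>j i. j \<le> m' \<Longrightarrow> i \<in> I \<Longrightarrow> degree (G j i) \<le> m' \<and> [:- b i, 1:] ^ e i dvd G j i"
    and Gsum: "\<And>j. j \<le> m' \<Longrightarrow> monom 1 j = sum (G j) I"
    using monom_as_sum_of_linear_powers[OF I] by blast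
  \<comment> \<open>Now the outer variable is decomposed: each \<open>t ^ j\<close> is replaced by
    its piece of index \<open>i\<close>. The coefficients of \<open>g i\<close> are real
    combinations of those of \<open>p\<close>, so degree bounds in \<open>s\<close> and divisibility
    by powers of \<open>s - a\<close> persist.\<close>
  define g where "g = (\<lambda>i. \<Sum>j\<le>m'. smult (coeff p j) (map_poly (\<lambda>c. [:c:]) (G j i)))"
  have cg: "coeff (g i) n = (\<Sum>j\<le>m'. smult (coeff (G j i) n) (coeff p j))" for i n
    by (simp add: g_def coeff_sum coeff_map_poly mult.commute)
  have "p = sum g I"
  proof (rule poly_eqI)
    fix n
    have "coeff (sum g I) n = (\<Sum>j\<le>m'. \<Sum>i\<in>I. smult (coeff (G j i) n) (coeff p j))"
      unfolding coeff_sum cg by (rule sum.swap)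
    also have "\<dots> = (\<Sum>j\<le>m'. smult (coeff (monom 1 j) n) (coeff p j))"
      by (intro sum.cong) (simp_all add: Gsum coeff_sum smult_sum)
    also have "\<dots> = (\<Sum>j\<le>m'. if n = j then coeff p j else 0)"
      by (intro sum.cong) auto
    also have "\<dots> = coeff p n"
      using p(1) by (simp add: bidegree_space_def coeff_eq_0)
    finally show "coeff p n = coeff (sum g I) n" ..
  qed
  moreover have "degree (g i) \<le> m'" if "i \<in> I" for i
  proof (rule degree_le, intro allI impI)
    fix n assume "m' < n"
    then have "coeff (G j i) n = 0" if "j \<le> m'" for j
      using G[OF that \<open>i \<in> I\<close>] by (simp add: coeff_eq_0)
    then show "coeff (g i) n = 0" by (simp add: cg)
  qed
  moreover have "degree (coeff (g i) n) \<le> m" for i n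
    unfolding cg using p(1)
    by (auto simp: bidegree_space_def intro!: degree_sum_le order.trans[OF degree_smult_le])
  moreover have "[:[:- a, 1:]:] ^ k dvd g i" for i
    using p(2) by (auto simp: poly_const_pow const_poly_dvd_iff cg intro!: dvd_sum dvd_smult)
  moreover have "[:[:- b i:], 1:] ^ e i dvd g i" if "i \<in> I" for i
    unfolding g_def
  proof (intro dvd_sum dvd_smult)
    fix j assume "j \<in> {..m'}"
    then have "[:- b i, 1:] ^ e i dvd G j i" using G that by auto
    then show "[:[:- b i:], 1:] ^ e i dvd map_poly (\<lambda>c. [:c:]) (G j i)"
      using map_poly_mult_linear_power[of "\<lambda>c. [:c:]" "- b i" "[:- b i:]" "e i"]
      by (auto elim!: dvdE)
  qed
  ultimately show ?thesis
    by (intro exI[of _ g]) (simp add: bidegree_space_def)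
qed

section \<open>Edges and maximal segments\<close>

lemma closed_segment_horizontal:
  assumes "a < (c :: real)"
  shows "closed_segment (a, b) (c, b) = {a..c} \<times> {b :: real}"
  using assms by (auto simp: closed_segment_same_snd closed_segment_eq_real_ivl1)

lemma closed_segment_vertical:
  assumes "b < (d :: real)"
  shows "closed_segment (a, b) (a, d) = {a :: real} \<times> {b..d}"
  using assms by (auto simp: closed_segment_same_fst closed_segment_eq_real_ivl1)

lemma rel_frontier_closed_segment:
  fixes p q :: "'a::euclidean_space"
  assumes "p \<noteq> q"
  shows "rel_frontier (closed_segment p q) = {p, q}"
  using assms by (auto simp: rel_frontier_def rel_interior_closed_segment open_segment_def)

lemma horizontalE:
  assumes "horizontal \<tau>"
  obtains a c b where "a < c" "\<tau> = {a..c} \<times> {b}" "rel_frontier \<tau> = {(a, b), (c, b)}"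
proof -
  obtain a c b where *: "a < c" "\<tau> = closed_segment (a, b) (c, b)"
    using assms unfolding horizontal_def by blast
  then have "rel_frontier \<tau> = {(a, b), (c, b)}" by (simp add: rel_frontier_closed_segment)
  with * show ?thesis using that[of a c b] by (simp add: closed_segment_horizontal)
qed

lemma verticalE:
  assumes "vertical \<tau>"
  obtains a b d where "b < d" "\<tau> = {a} \<times> {b..d}" "rel_frontier \<tau> = {(a, b), (a, d)}"
proof -
  obtain a b d where *: "b < d" "\<tau> = closed_segment (a, b) (a, d)"
    using assms unfolding vertical_def by blast
  then have "rel_frontier \<tau> = {(a, b), (a, d)}" by (simp add: rel_frontier_closed_segment)
  with * show ?thesis using that[of b d a] by (simp add: closed_segment_vertical)
qed

lemma
  assumes "horizontal \<tau> \<or> vertical \<tau>"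
  shows closed_edge: "closed \<tau>" and connected_edge: "connected \<tau>" and edge_nonempty: "\<tau> \<noteq> {}"
    and finite_edge_frontier: "finite (rel_frontier \<tau>)"
    and edge_frontier_subset: "rel_frontier \<tau> \<subseteq> \<tau>"
    and closure_open_edge: "\<tau> = closure (\<tau> - rel_frontier \<tau>)"
proof -
  obtain p q where pq: "p \<noteq> q" "\<tau> = closed_segment p q"
    using assms unfolding horizontal_def vertical_def by (metis prod.inject less_irrefl)
  then have f: "rel_frontier \<tau> = {p, q}" by (simp add: rel_frontier_closed_segment)
  show "closed \<tau>" "connected \<tau>" "\<tau> \<noteq> {}" "finite (rel_frontier \<tau>)" "rel_frontier \<tau> \<subseteq> \<tau>"
    using pq f by auto
  show "\<tau> = closure (\<tau> - rel_frontier \<tau>)"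
    unfolding f using pq by (simp add: open_segment_def [symmetric])
qed

lemma snd_horizontal:
  assumes "horizontal \<tau>" "x \<in> \<tau>"
  shows "snd x = the_elem (snd ` \<tau>)"
  using assms(1)
proof (rule horizontalE)
  fix a b c :: real assume "a < c" "\<tau> = {a..c} \<times> {b}"
  then have "snd ` \<tau> = {b}" "snd x = b" using assms(2) by auto
  then show ?thesis by simp
qed

lemma fst_vertical:
  assumes "vertical \<tau>" "x \<in> \<tau>"
  shows "fst x = the_elem (fst ` \<tau>)"
  using assms(1)
proof (rule verticalE)
  fix a b d :: real assume "b < d" "\<tau> = {a} \<times> {b..d}"
  then have "fst ` \<tau> = {a}" "fst x = a" using assms(2) by auto
  then show ?thesis by simp
qed

lemma not_horizontal_vertical: "horizontal \<tau> \<Longrightarrow> \<not> vertical \<tau>"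
proof
  assume "horizontal \<tau>" "vertical \<tau>"
  then obtain a c b where *: "a < c" "\<tau> = {a..c} \<times> {b}" by (auto elim: horizontalE)
  then have "(a, b) \<in> \<tau>" "(c, b) \<in> \<tau>" by auto
  with \<open>vertical \<tau>\<close> have "fst (a, b) = fst (c, b)" using fst_vertical by metis
  with * show False by simp
qed

text \<open>Any point of the edge determines its supporting line. At a vertex this makes the spaces
  of both directions comparable with the coordinates of that vertex.\<close>

lemma edge_space_horizontal:
  assumes "horizontal \<tau>" "x \<in> \<tau>"
  shows "edge_space r m m' \<tau> = {p. [:[:- snd x:], 1:] ^ (snd r (snd x) + 1) dvd p} \<inter> bidegree_space m m'"
  using snd_horizontal[OF assms] not_horizontal_vertical[OF assms(1)]
  by (simp add: edge_space_def line_poly_def edge_smoothness_def)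

lemma edge_space_vertical:
  assumes "vertical \<tau>" "x \<in> \<tau>"
  shows "edge_space r m m' \<tau> = {p. [:[:- fst x, 1:]:] ^ (fst r (fst x) + 1) dvd p} \<inter> bidegree_space m m'"
  using fst_vertical[OF assms] assms(1)
  by (simp add: edge_space_def line_poly_def edge_smoothness_def)

lemma zero_in_edge_space: "0 \<in> edge_space r m m' \<tau>"
  by (simp add: edge_space_def bidegree_space_def)

lemma edge_space_diff:
  "p \<in> edge_space r m m' \<tau> \<Longrightarrow> q \<in> edge_space r m m' \<tau> \<Longrightarrow> p - q \<in> edge_space r m m' \<tau>"
  by (auto simp: edge_space_def bidegree_space_def intro: degree_diff_le dvd_diff)

text \<open>Take for \<open>\<epsilon>\<close> the distance from \<open>x\<close> to the nearer end
  point. Along the edge, a displacement shorter than \<open>\<epsilon>\<close> from \<open>x\<close>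
  stays within the extent of the edge, hence of the rectangle; across it, \<open>x\<close> and
  \<open>y\<close> have the same coordinate.\<close>

lemma rectangle_along_edge:
  assumes "horizontal \<tau> \<or> vertical \<tau>" "x \<in> \<tau> - rel_frontier \<tau>" "y \<in> \<tau>"
  obtains \<epsilon> where "\<epsilon> > 0"
    "\<And>\<sigma> v. is_rectangle \<sigma> \<Longrightarrow> \<tau> \<subseteq> \<sigma> \<Longrightarrow> norm v < \<epsilon> \<Longrightarrow> y + v \<in> \<sigma> \<Longrightarrow> x + v \<in> \<sigma>"
  using assms(1)
proof
  assume "horizontal \<tau>"
  then obtain u w h where *: "u < w" "\<tau> = {u..w} \<times> {h}" "rel_frontier \<tau> = {(u, h), (w, h)}"
    by (rule horizontalE)
  define \<epsilon> where "\<epsilon> = min (fst x - u) (w - fst x)"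
  have x: "snd x = h" "snd y = h"
    using assms(2,3) unfolding *(2) by auto
  have "\<epsilon> > 0"
    using assms(2) unfolding *(3) unfolding *(2) by (cases x) (auto simp: \<epsilon>_def)
  moreover have "x + v \<in> \<sigma>"
    if "is_rectangle \<sigma>" "\<tau> \<subseteq> \<sigma>" "norm v < \<epsilon>" "y + v \<in> \<sigma>" for \<sigma> v
  proof -
    obtain a b c d where \<sigma>: "\<sigma> = {a..c} \<times> {b..d}"
      using \<open>is_rectangle \<sigma>\<close> by (auto simp: is_rectangle_def cbox_Pair_eq)
    have "(u, h) \<in> \<sigma>" "(w, h) \<in> \<sigma>" using \<open>\<tau> \<subseteq> \<sigma>\<close> *(1,2) by auto
    then have "a \<le> u" "w \<le> c" by (auto simp: \<sigma>)
    moreover have "\<bar>fst v\<bar> < \<epsilon>"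
      using norm_fst_le[of "fst v" "snd v"] \<open>norm v < \<epsilon>\<close> by simp
    ultimately show ?thesis using \<open>y + v \<in> \<sigma>\<close> x
      by (auto simp: \<sigma> \<epsilon>_def mem_Times_iff)
  qed
  ultimately show ?thesis by (rule that)
next
  assume "vertical \<tau>"
  then obtain u w h where *: "u < w" "\<tau> = {h} \<times> {u..w}" "rel_frontier \<tau> = {(h, u), (h, w)}"
    by (rule verticalE)
  define \<epsilon> where "\<epsilon> = min (snd x - u) (w - snd x)"
  have x: "fst x = h" "fst y = h"
    using assms(2,3) unfolding *(2) by auto
  have "\<epsilon> > 0"
    using assms(2) unfolding *(3) unfolding *(2) by (cases x) (auto simp: \<epsilon>_def)
  moreover have "x + v \<in> \<sigma>"
    if "is_rectangle \<sigma>" "\<tau> \<subseteq> \<sigma>" "norm v < \<epsilon>" "y + v \<in> \<sigma>" for \<sigma> v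
  proof -
    obtain a b c d where \<sigma>: "\<sigma> = {a..c} \<times> {b..d}"
      using \<open>is_rectangle \<sigma>\<close> by (auto simp: is_rectangle_def cbox_Pair_eq)
    have "(h, u) \<in> \<sigma>" "(h, w) \<in> \<sigma>" using \<open>\<tau> \<subseteq> \<sigma>\<close> *(1,2) by auto
    then have "b \<le> u" "w \<le> d" by (auto simp: \<sigma>)
    moreover have "\<bar>snd v\<bar> < \<epsilon>"
      using norm_snd_le[of "snd v" "fst v"] \<open>norm v < \<epsilon>\<close> by simp
    ultimately show ?thesis using \<open>y + v \<in> \<sigma>\<close> x
      by (auto simp: \<sigma> \<epsilon>_def mem_Times_iff)
  qed
  ultimately show ?thesis by (rule that)
qed

text \<open>The members with \<open>P\<close> and those without have closed unions that cover the
  whole. If \<open>P\<close> did not spread to all members, these unions would be disjoint and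
  nonempty, against connectedness.\<close>

lemma connected_Union_propagate:
  assumes "finite S" "\<And>\<tau>. \<tau> \<in> S \<Longrightarrow> closed \<tau> \<and> \<tau> \<noteq> {}" "connected (\<Union>S)"
    and "\<tau> \<in> S" "P \<tau>"
    and "\<And>\<tau> \<tau>'. \<tau> \<in> S \<Longrightarrow> \<tau>' \<in> S \<Longrightarrow> P \<tau> \<Longrightarrow> \<tau> \<inter> \<tau>' \<noteq> {} \<Longrightarrow> P \<tau>'"
    and "\<tau>' \<in> S"
  shows "P \<tau>'"
proof (rule ccontr)
  assume "\<not> P \<tau>'"
  define A where "A = \<Union>{\<tau> \<in> S. P \<tau>}"
  define B where "B = \<Union>{\<tau> \<in> S. \<not> P \<tau>}"
  have "closed A" "closed B"
    unfolding A_def B_def using assms(1,2) by (auto intro!: closed_Union)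
  moreover have "\<Union>S \<subseteq> A \<union> B" by (auto simp: A_def B_def)
  moreover have "A \<inter> B = {}" using assms(6) by (fastforce simp: A_def B_def)
  moreover have "A \<inter> \<Union>S \<noteq> {}" using assms(2,4,5) by (fastforce simp: A_def)
  moreover have "B \<inter> \<Union>S \<noteq> {}" using assms(2,7) \<open>\<not> P \<tau>'\<close> by (fastforce simp: B_def)
  ultimately show False using assms(3) unfolding connected_closed by blast
qed

section \<open>Incidence of edges and cells in a T-mesh\<close>

lemma interior_edges_subset: "interior_edges T \<subseteq> edges T"
  by (auto simp: interior_edges_def)

lemma finite_edges: "tmesh T \<Longrightarrow> finite (edges T)"
  by (simp add: tmesh_def)

lemma finite_interior_edges: "tmesh T \<Longrightarrow> finite (interior_edges T)"
  using interior_edges_subset finite_edges by (rule finite_subset)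

lemma edge_direction: "tmesh T \<Longrightarrow> \<tau> \<in> edges T \<Longrightarrow> horizontal \<tau> \<or> vertical \<tau>"
  by (simp add: tmesh_def)

lemma interior_edge_direction: "tmesh T \<Longrightarrow> \<tau> \<in> interior_edges T \<Longrightarrow> horizontal \<tau> \<or> vertical \<tau>"
  by (simp add: edge_direction interior_edges_def)

lemma edges_Int:
  "tmesh T \<Longrightarrow> \<tau> \<in> edges T \<Longrightarrow> \<tau>' \<in> edges T \<Longrightarrow> \<tau> \<noteq> \<tau>' \<Longrightarrow> \<tau> \<inter> \<tau>' = rel_frontier \<tau> \<inter> rel_frontier \<tau>'"
  by (simp add: tmesh_def)

lemma closed_cell:
  assumes "tmesh T" "\<sigma> \<in> cells T"
  shows "closed \<sigma>"
proof -
  have "is_rectangle \<sigma>" using assms by (simp add: tmesh_def)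
  then show ?thesis by (auto simp: is_rectangle_def)
qed

text \<open>The point \<open>x\<close> lies on the frontier of some cell, and distinct cells meet
  only in their frontiers, so \<open>x\<close> is on the frontier of \<open>\<sigma>\<close>. This
  frontier is a union of edges, and the one through \<open>x\<close> must be \<open>\<tau>\<close>,
  as distinct edges share only end points.\<close>

lemma edge_subset_cell:
  assumes T: "tmesh T" and \<tau>: "\<tau> \<in> edges T" "x \<in> \<tau> - rel_frontier \<tau>" and \<sigma>: "\<sigma> \<in> cells T" "x \<in> \<sigma>"
  shows "\<tau> \<subseteq> \<sigma>"
proof -
  have "\<tau> \<subseteq> (\<Union>\<sigma>\<in>cells T. frontier \<sigma>)" using T \<tau>(1) by (simp add: tmesh_def)
  then obtain \<sigma>' where \<sigma>': "\<sigma>' \<in> cells T" "x \<in> frontier \<sigma>'" using \<tau>(2) by blast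
  have xf: "x \<in> frontier \<sigma>"
  proof (cases "\<sigma> = \<sigma>'")
    case False
    then have "\<sigma> \<inter> \<sigma>' = frontier \<sigma> \<inter> frontier \<sigma>'" using T \<sigma>(1) \<sigma>'(1) by (simp add: tmesh_def)
    moreover have "x \<in> \<sigma>'" using \<sigma>' closed_cell[OF T \<sigma>'(1)] frontier_subset_closed by blast
    ultimately show ?thesis using \<sigma>(2) by blast
  qed (use \<sigma>' in simp)
  have "\<exists>S. finite S \<and> S \<subseteq> edges T \<and> frontier \<sigma> = \<Union>S"
    using T \<sigma>(1) by (simp add: tmesh_def)
  then obtain S where S: "S \<subseteq> edges T" "frontier \<sigma> = \<Union>S" by blast
  then obtain \<tau>' where \<tau>': "\<tau>' \<in> S" "x \<in> \<tau>'" using xf by blast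
  have "\<tau>' = \<tau>"
  proof (rule ccontr)
    assume "\<tau>' \<noteq> \<tau>"
    then have "\<tau> \<inter> \<tau>' = rel_frontier \<tau> \<inter> rel_frontier \<tau>'"
      using edges_Int[OF T \<tau>(1)] \<tau>'(1) S(1) by blast
    then show False using \<tau>(2) \<tau>'(2) by blast
  qed
  then show ?thesis using \<tau>'(1) S(2) closed_cell[OF T \<sigma>(1)] frontier_subset_closed by blast
qed

text \<open>The cells at a point of an open edge are exactly those that contain the whole edge, and near
  such a point each of them looks the same as near any other. So the whole open edge lies in the
  interior of the domain as soon as one of its points does.\<close>

lemma interior_edge_subset_interior:
  assumes T: "tmesh T" and \<tau>: "\<tau> \<in> interior_edges T" and x: "x \<in> \<tau> - rel_frontier \<tau>"
  shows "x \<in> interior (domain T)"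
proof -
  let ?\<Omega> = "domain T"
  have \<tau>e: "\<tau> \<in> edges T" using \<tau> by (simp add: interior_edges_def)
  then have hv: "horizontal \<tau> \<or> vertical \<tau>" using T by (simp add: tmesh_def)
  have "interior ?\<Omega> \<inter> closure (\<tau> - rel_frontier \<tau>) \<noteq> {}"
    using \<tau> closure_open_edge[OF hv] by (auto simp: interior_edges_def)
  then obtain y where y: "y \<in> interior ?\<Omega>" "y \<in> \<tau> - rel_frontier \<tau>"
    using open_Int_closure_eq_empty[OF open_interior] by blast
  have rect: "is_rectangle \<sigma>" if "\<sigma> \<in> cells T" for \<sigma> using T that by (simp add: tmesh_def)
  \<comment> \<open>Removing the cells that miss \<open>y\<close> leaves a neighbourhood of
    \<open>y\<close> in which every point lies in a cell through \<open>y\<close>, hence in a cell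
    containing \<open>\<tau>\<close>.\<close>
  define U where "U = interior ?\<Omega> \<inter> - \<Union>{\<sigma> \<in> cells T. y \<notin> \<sigma>}"
  have "closed (\<Union>{\<sigma> \<in> cells T. y \<notin> \<sigma>})"
  proof (rule closed_Union)
    show "finite {\<sigma> \<in> cells T. y \<notin> \<sigma>}" using T by (simp add: tmesh_def)
    show "\<forall>\<sigma>\<in>{\<sigma> \<in> cells T. y \<notin> \<sigma>}. closed \<sigma>"
      using closed_cell[OF T] by blast
  qed
  then have "open U" by (auto simp: U_def)
  moreover have "y \<in> U" using y by (auto simp: U_def)
  ultimately obtain \<delta> where \<delta>: "\<delta> > 0" "ball y \<delta> \<subseteq> U" by (rule openE)
  obtain \<epsilon> where \<epsilon>: "\<epsilon> > 0"
    "\<And>\<sigma> v. is_rectangle \<sigma> \<Longrightarrow> \<tau> \<subseteq> \<sigma> \<Longrightarrow> norm v < \<epsilon> \<Longrightarrow> y + v \<in> \<sigma> \<Longrightarrow> x + v \<in> \<sigma>"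
    using rectangle_along_edge[OF hv x, of y] y(2) by blast
  have "ball x (min \<delta> \<epsilon>) \<subseteq> ?\<Omega>"
  proof
    fix z assume z: "z \<in> ball x (min \<delta> \<epsilon>)"
    define v where "v = z - x"
    have v: "norm v < \<delta>" "norm v < \<epsilon>" using z by (simp_all add: v_def dist_norm norm_minus_commute)
    then have "y + v \<in> U" using \<delta>(2) by (auto simp: dist_norm)
    then obtain \<sigma> where \<sigma>: "\<sigma> \<in> cells T" "y + v \<in> \<sigma>" "y \<in> \<sigma>"
      using interior_subset[of ?\<Omega>] by (auto simp: U_def domain_def)
    then have "x + v \<in> \<sigma>" using \<epsilon>(2) rect v(2) edge_subset_cell[OF T \<tau>e y(2)] by blast
    then show "z \<in> ?\<Omega>" using \<sigma>(1) by (auto simp: v_def domain_def)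
  qed
  then show ?thesis using \<delta>(1) \<epsilon>(1) unfolding mem_interior by (metis min_less_iff_conj)
qed

section \<open>Maximal segments as connected unions of edges\<close>

lemma maximal_segment_Union:
  assumes T: "tmesh T" and \<tau>: "\<tau> \<in> interior_edges T"
  obtains S where "\<tau> \<in> S" "S \<subseteq> {\<tau>' \<in> interior_edges T. horizontal \<tau>' \<longleftrightarrow> horizontal \<tau>}"
    "maximal_segment T \<tau> = \<Union>S" "connected (\<Union>S)"
proof
  let ?E = "{\<tau>' \<in> interior_edges T. horizontal \<tau>' \<longleftrightarrow> horizontal \<tau>}"
  let ?F = "{S. S \<subseteq> ?E \<and> \<tau> \<subseteq> \<Union>S \<and> connected (\<Union>S)}"
  have hv: "horizontal \<tau> \<or> vertical \<tau>" using T \<tau> by (rule interior_edge_direction)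
  then have "{\<tau>} \<in> ?F" using \<tau> connected_edge[OF hv] by simp
  then show "\<tau> \<in> \<Union>?F" by blast
  show "\<Union>?F \<subseteq> ?E" by blast
  show *: "maximal_segment T \<tau> = \<Union>(\<Union>?F)" unfolding maximal_segment_def by blast
  \<comment> \<open>All these connected unions have the nonempty edge \<open>\<tau>\<close> in
    common.\<close>
  have "connected (\<Union>(Union ` ?F))"
  proof (rule connected_Union)
    have "\<tau> \<subseteq> \<Inter>(Union ` ?F)" by blast
    then show "\<Inter>(Union ` ?F) \<noteq> {}" using edge_nonempty[OF hv] by blast
  qed blast
  moreover have "\<Union>(Union ` ?F) = \<Union>(\<Union>?F)" by blast
  ultimately show "connected (\<Union>(\<Union>?F))" by simp
qed

text \<open>The form in which connectedness of a segment is used: walking from \<open>\<tau>\<close>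
  to an edge through \<open>x\<close> across touching edges of the same direction.\<close>

lemma maximal_segment_propagate:
  assumes T: "tmesh T" and \<tau>: "\<tau> \<in> interior_edges T" and "P \<tau>"
    and step: "\<And>\<tau>1 \<tau>2. \<tau>1 \<in> interior_edges T \<Longrightarrow> \<tau>2 \<in> interior_edges T \<Longrightarrow>
      (horizontal \<tau>1 \<longleftrightarrow> horizontal \<tau>) \<Longrightarrow> (horizontal \<tau>2 \<longleftrightarrow> horizontal \<tau>) \<Longrightarrow>
      P \<tau>1 \<Longrightarrow> \<tau>1 \<inter> \<tau>2 \<noteq> {} \<Longrightarrow> P \<tau>2"
    and x: "x \<in> maximal_segment T \<tau>"
  obtains \<tau>' where "\<tau>' \<in> interior_edges T" "horizontal \<tau>' \<longleftrightarrow> horizontal \<tau>" "P \<tau>'" "x \<in> \<tau>'"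
    "\<tau>' \<subseteq> maximal_segment T \<tau>"
proof -
  obtain S where S: "\<tau> \<in> S" "S \<subseteq> {\<tau>' \<in> interior_edges T. horizontal \<tau>' \<longleftrightarrow> horizontal \<tau>}"
    "maximal_segment T \<tau> = \<Union>S" "connected (\<Union>S)"
    by (rule maximal_segment_Union[OF T \<tau>])
  obtain \<tau>' where \<tau>': "\<tau>' \<in> S" "x \<in> \<tau>'" using x S(3) by blast
  have E: "S \<subseteq> edges T" using S(2) interior_edges_subset by blast
  have "P \<tau>'"
  proof (rule connected_Union_propagate[where P = P, OF _ _ S(4) S(1) \<open>P \<tau>\<close> _ \<tau>'(1)])
    show "finite S" using E T by (meson finite_edges finite_subset)
    show "closed \<tau> \<and> \<tau> \<noteq> {}" if "\<tau> \<in> S" for \<tau>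
      using that E closed_edge[OF edge_direction[OF T]] edge_nonempty[OF edge_direction[OF T]] by blast
    show "P \<tau>2" if "\<tau>1 \<in> S" "\<tau>2 \<in> S" "P \<tau>1" "\<tau>1 \<inter> \<tau>2 \<noteq> {}" for \<tau>1 \<tau>2
      using step[of \<tau>1 \<tau>2] that S(2) by blast
  qed
  then show ?thesis using that \<tau>' S by blast
qed

lemma subset_maximal_segment:
  assumes "tmesh T" "\<tau> \<in> interior_edges T"
  shows "\<tau> \<subseteq> maximal_segment T \<tau>"
proof -
  obtain S where "\<tau> \<in> S" "maximal_segment T \<tau> = \<Union>S"
    by (rule maximal_segment_Union[OF assms])
  then show ?thesis by blast
qed

lemma snd_maximal_segment:
  assumes T: "tmesh T" and \<tau>: "\<tau> \<in> interior_edges T" "horizontal \<tau>" "x \<in> \<tau>"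
    and "z \<in> maximal_segment T \<tau>"
  shows "snd z = snd x"
proof (rule maximal_segment_propagate[OF T \<tau>(1) _ _ assms(5), of "\<lambda>\<tau>'. \<forall>y\<in>\<tau>'. snd y = snd x"])
  show "\<forall>y\<in>\<tau>. snd y = snd x" using \<tau> snd_horizontal by metis
next
  fix \<tau>1 \<tau>2 assume "horizontal \<tau>2 \<longleftrightarrow> horizontal \<tau>" "\<forall>y\<in>\<tau>1. snd y = snd x" "\<tau>1 \<inter> \<tau>2 \<noteq> {}"
  then obtain w where w: "w \<in> \<tau>2" "snd w = snd x" "horizontal \<tau>2" using \<tau>(2) by blast
  then show "\<forall>y\<in>\<tau>2. snd y = snd x" using snd_horizontal by metis
qed blast

lemma fst_maximal_segment:
  assumes T: "tmesh T" and \<tau>: "\<tau> \<in> interior_edges T" "vertical \<tau>" "x \<in> \<tau>"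
    and "z \<in> maximal_segment T \<tau>"
  shows "fst z = fst x"
proof (rule maximal_segment_propagate[OF T \<tau>(1) _ _ assms(5), of "\<lambda>\<tau>'. \<forall>y\<in>\<tau>'. fst y = fst x"])
  show "\<forall>y\<in>\<tau>. fst y = fst x" using \<tau> fst_vertical by metis
next
  fix \<tau>1 \<tau>2 assume *: "\<tau>2 \<in> interior_edges T" "horizontal \<tau>2 \<longleftrightarrow> horizontal \<tau>"
    "\<forall>y\<in>\<tau>1. fst y = fst x" "\<tau>1 \<inter> \<tau>2 \<noteq> {}"
  then have "vertical \<tau>2"
    using interior_edge_direction[OF T *(1)] not_horizontal_vertical[of \<tau>] \<tau>(2) by blast
  moreover obtain w where w: "w \<in> \<tau>2" "fst w = fst x" using * by blast
  ultimately show "\<forall>y\<in>\<tau>2. fst y = fst x" using fst_vertical by metis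
qed blast

text \<open>The end points of a vertical edge differ in the second coordinate, which is constant on
  a horizontal segment. With this, injectivity of the ordering compares crossing interior segments
  strictly.\<close>

lemma maximal_segments_distinct:
  assumes T: "tmesh T" and \<tau>: "\<tau> \<in> interior_edges T" "horizontal \<tau>"
    and \<tau>': "\<tau>' \<in> interior_edges T" "vertical \<tau>'"
  shows "maximal_segment T \<tau> \<noteq> maximal_segment T \<tau>'"
proof
  assume eq: "maximal_segment T \<tau> = maximal_segment T \<tau>'"
  obtain a b d where *: "b < d" "\<tau>' = {a} \<times> {b..d}" using \<tau>'(2) by (rule verticalE)
  obtain x where x: "x \<in> \<tau>" using \<tau>(2) edge_nonempty by blast
  have "(a, b) \<in> \<tau>'" "(a, d) \<in> \<tau>'" using * by auto
  then have "(a, b) \<in> maximal_segment T \<tau>" "(a, d) \<in> maximal_segment T \<tau>"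
    using subset_maximal_segment[OF T \<tau>'(1)] eq by auto
  from this[THEN snd_maximal_segment[OF T \<tau> x]] have "b = snd x" "d = snd x" by simp_all
  then show False using * by simp
qed

text \<open>A vertex is an end point of some edge, and distinct edges meet only in common end
  points; so no vertex lies inside an edge.\<close>

lemma vertex_end_point:
  assumes T: "tmesh T" and "\<tau> \<in> edges T" "\<gamma> \<in> vertices T" "\<gamma> \<in> \<tau>"
  shows "\<gamma> \<in> rel_frontier \<tau>"
proof -
  obtain \<tau>' where \<tau>': "\<tau>' \<in> edges T" "\<gamma> \<in> rel_frontier \<tau>'" using assms(3) by (auto simp: vertices_def)
  have "\<gamma> \<in> \<tau>'" using \<tau>'(2) edge_frontier_subset[OF edge_direction[OF T \<tau>'(1)]] by blast
  show ?thesis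
  proof (cases "\<tau> = \<tau>'")
    case False
    then have "\<tau> \<inter> \<tau>' = rel_frontier \<tau> \<inter> rel_frontier \<tau>'"
      using edges_Int[OF T assms(2) \<tau>'(1)] by blast
    then show ?thesis using \<open>\<gamma> \<in> \<tau>'\<close> assms(4) by blast
  qed (use \<tau>' in simp)
qed

lemma edge_space_touching:
  assumes "horizontal \<tau> \<or> vertical \<tau>" "horizontal \<tau>' \<or> vertical \<tau>'"
    and "horizontal \<tau> \<longleftrightarrow> horizontal \<tau>'" "\<tau> \<inter> \<tau>' \<noteq> {}"
  shows "edge_space r m m' \<tau> = edge_space r m m' \<tau>'"
proof -
  obtain x where "x \<in> \<tau>" "x \<in> \<tau>'" using assms(4) by blast
  then show ?thesis
    using assms(1-3) by (cases "horizontal \<tau>") (simp_all add: edge_space_horizontal[of _ x] edge_space_vertical[of _ x])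
qed

lemma maximal_segment_subset_interior:
  assumes T: "tmesh T" and \<tau>: "\<tau> \<in> interior_edges T"
    and "maximal_segment T \<tau> \<inter> frontier (domain T) = {}"
  shows "maximal_segment T \<tau> \<subseteq> interior (domain T)"
proof
  fix x assume x: "x \<in> maximal_segment T \<tau>"
  obtain S where S: "S \<subseteq> {\<tau>' \<in> interior_edges T. horizontal \<tau>' \<longleftrightarrow> horizontal \<tau>}"
    "maximal_segment T \<tau> = \<Union>S"
    by (rule maximal_segment_Union[OF T \<tau>])
  then obtain \<tau>' where \<tau>': "\<tau>' \<in> edges T" "x \<in> \<tau>'"
    using x interior_edges_subset by blast
  have "\<tau>' \<subseteq> (\<Union>\<sigma>\<in>cells T. frontier \<sigma>)" using T \<tau>' by (simp add: tmesh_def)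
  then obtain \<sigma> where \<sigma>: "\<sigma> \<in> cells T" "x \<in> frontier \<sigma>" using \<tau>'(2) by blast
  have "closed \<sigma>" using T \<sigma>(1) by (rule closed_cell)
  then have "x \<in> domain T" using \<sigma> frontier_subset_closed[of \<sigma>] by (auto simp: domain_def)
  moreover have "x \<notin> frontier (domain T)" using x assms(3) by blast
  ultimately show "x \<in> interior (domain T)"
    using closure_subset[of "domain T"] by (auto simp: frontier_def)
qed

section \<open>Surjectivity of the boundary map\<close>
text \<open>A representative in a basis would lie in \<open>W\<close>, violating independence with
  the single coefficient \<open>1\<close>. So the empty set, which is a basis, is the only choice
  for \<open>SOME\<close>.\<close>

lemma (in vector_space) quotient_dim_eq_0:
  assumes "V \<subseteq> W"
  shows "quotient_dim V W = 0"
proof -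
  have "B = {}" if "quotient_basis V W B" for B
  proof (rule ccontr)
    assume "B \<noteq> {}"
    then obtain v where "v \<in> B" by blast
    then have "finite {v}" "{v} \<subseteq> B" "(\<Sum>x\<in>{v}. scale 1 x) \<in> W"
      using that assms by (auto simp: quotient_basis_def)
    with that have "\<forall>x\<in>{v}. (1::'a) = 0"
      unfolding quotient_basis_def by (elim conjE allE[of _ "{v}"] allE[of _ "\<lambda>_. 1"]) blast
    then show False by simp
  qed
  moreover have "quotient_basis V W {}"
    using assms by (auto simp: quotient_basis_def intro: span_base)
  ultimately have "(SOME B. quotient_basis V W B) = {}" by (metis someI_ex)
  then show ?thesis by (simp add: quotient_dim_def)
qed

text \<open>Truncated subtraction replaces negative summands by \<open>0\<close>, which only
  increases the sum. The exponents are \<open>s \<gamma> + 1\<close>, so the shifts by one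
  cancel.\<close>

lemma less_sum_nat_of_int_weight:
  assumes "int (n + 1) \<le> (\<Sum>\<gamma>\<in>G. int n - int (s \<gamma>))"
  shows "n < (\<Sum>\<gamma>\<in>G. n + 1 - (s \<gamma> + 1))"
proof -
  have "(\<Sum>\<gamma>\<in>G. int n - int (s \<gamma>)) \<le> (\<Sum>\<gamma>\<in>G. int (n + 1 - (s \<gamma> + 1)))"
    by (intro sum_mono) auto
  then show ?thesis using assms unfolding of_nat_sum [symmetric] by linarith
qed

section \<open>Chains modulo boundaries\<close>

lemma sum_single_lookup: "(\<Sum>k\<in>Poly_Mapping.keys c. Poly_Mapping.single k (Poly_Mapping.lookup c k)) = c"
  by (rule poly_mapping_eqI) (simp add: lookup_sum lookup_single when_def in_keys_iff)

lemma vertex_term_0: "vertex_term T \<gamma> 0 = 0"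
  and vertex_term_diff: "vertex_term T \<gamma> (p - q) = vertex_term T \<gamma> p - vertex_term T \<gamma> q"
  and vertex_term_add: "vertex_term T \<gamma> (p + q) = vertex_term T \<gamma> p + vertex_term T \<gamma> q"
  by (simp_all add: vertex_term_def single_diff single_add)

lemma vertex_term_sum: "vertex_term T \<gamma> (sum f I) = (\<Sum>i\<in>I. vertex_term T \<gamma> (f i))"
  by (induction I rule: infinite_finite_induct) (simp_all add: vertex_term_0 vertex_term_add)

locale oriented_tmesh =
  fixes T :: mesh and r :: smoothness and m m' :: nat and d :: "point set \<Rightarrow> point \<times> point"
  assumes T: "tmesh T" and d: "orientation T d"
begin

definition boundaries :: "(point \<Rightarrow>\<^sub>0 bipoly) set" where
  "boundaries = boundary1 T d ` chains1 T r m m'"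

abbreviation \<rho> :: "point set \<Rightarrow> point set" where
  "\<rho> \<equiv> maximal_segment T"

text \<open>Summing over a set independent of \<open>c\<close> makes linearity visible.\<close>

lemma boundary1_eq:
  assumes "Poly_Mapping.keys c \<subseteq> interior_edges T"
  shows "boundary1 T d c = (\<Sum>\<tau>\<in>interior_edges T.
    vertex_term T (snd (d \<tau>)) (Poly_Mapping.lookup c \<tau>) -
    vertex_term T (fst (d \<tau>)) (Poly_Mapping.lookup c \<tau>))"
  unfolding boundary1_def
  by (intro sum.mono_neutral_left finite_interior_edges[OF T] assms)
    (simp add: in_keys_iff vertex_term_0)

lemma boundaries_diff:
  assumes "x \<in> boundaries" "y \<in> boundaries"
  shows "x - y \<in> boundaries"
proof -
  obtain a b where ab: "a \<in> chains1 T r m m'" "x = boundary1 T d a"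
      "b \<in> chains1 T r m m'" "y = boundary1 T d b"
    using assms by (auto simp: boundaries_def)
  then have k: "Poly_Mapping.keys a \<subseteq> interior_edges T" "Poly_Mapping.keys b \<subseteq> interior_edges T"
    "Poly_Mapping.keys (a - b) \<subseteq> interior_edges T"
    using keys_diff[of a b] by (auto simp: chains1_def)
  have "a - b \<in> chains1 T r m m'"
    using ab k(3) by (auto simp: chains1_def lookup_minus intro: edge_space_diff)
  moreover have "boundary1 T d (a - b) = x - y"
    unfolding ab boundary1_eq[OF k(1)] boundary1_eq[OF k(2)] boundary1_eq[OF k(3)]
    by (simp add: lookup_minus vertex_term_diff sum_subtractf)
  ultimately show ?thesis unfolding boundaries_def by (metis imageI)
qed

lemma boundaries_0: "0 \<in> boundaries"
proof -
  have "0 \<in> chains1 T r m m'" by (simp add: chains1_def zero_in_edge_space)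
  moreover have "boundary1 T d 0 = 0" by (simp add: boundary1_def)
  ultimately show ?thesis unfolding boundaries_def by (metis imageI)
qed

lemma boundaries_add: "x \<in> boundaries \<Longrightarrow> y \<in> boundaries \<Longrightarrow> x + y \<in> boundaries"
  using boundaries_diff[of x "0 - y"] boundaries_diff[of 0 y] boundaries_0 by simp

lemma boundaries_sum: "(\<And>i. i \<in> I \<Longrightarrow> f i \<in> boundaries) \<Longrightarrow> sum f I \<in> boundaries"
  by (induction I rule: infinite_finite_induct) (auto simp: boundaries_0 boundaries_add)

text \<open>Up to sign, or trivially if \<open>\<gamma> = \<gamma>'\<close>, this is the boundary of
  \<open>[\<tau>] p\<close>.\<close>

lemma boundaries_edge:
  assumes \<tau>: "\<tau> \<in> interior_edges T" and p: "p \<in> edge_space r m m' \<tau>"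
    and "\<gamma> \<in> rel_frontier \<tau>" "\<gamma>' \<in> rel_frontier \<tau>"
  shows "vertex_term T \<gamma> p - vertex_term T \<gamma>' p \<in> boundaries"
proof -
  let ?c = "Poly_Mapping.single \<tau> p"
  have c: "?c \<in> chains1 T r m m'"
    using \<tau> p by (auto simp: chains1_def lookup_single when_def zero_in_edge_space)
  have "boundary1 T d ?c = vertex_term T (snd (d \<tau>)) p - vertex_term T (fst (d \<tau>)) p"
    by (cases "p = 0") (simp_all add: boundary1_def vertex_term_0)
  then have 1: "vertex_term T (snd (d \<tau>)) p - vertex_term T (fst (d \<tau>)) p \<in> boundaries"
    using c unfolding boundaries_def by (metis imageI)
  then have 2: "vertex_term T (fst (d \<tau>)) p - vertex_term T (snd (d \<tau>)) p \<in> boundaries"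
    using boundaries_diff[OF boundaries_0 1] by simp
  have "rel_frontier \<tau> = {fst (d \<tau>), snd (d \<tau>)}"
    using d \<tau> interior_edges_subset unfolding orientation_def by blast
  then show ?thesis using assms(3,4) 1 2 boundaries_0 by auto
qed

text \<open>Touching edges of the same direction have the same polynomial space and share an end
  point, so the differences from single edges telescope along the segment.\<close>

lemma boundaries_segment:
  assumes \<tau>: "\<tau> \<in> interior_edges T" and p: "p \<in> edge_space r m m' \<tau>"
    and \<gamma>: "\<gamma> \<in> rel_frontier \<tau>" and x: "x \<in> \<rho> \<tau>"
  obtains \<tau>' where "\<tau>' \<in> interior_edges T" "x \<in> \<tau>'"
    "\<forall>\<gamma>'\<in>rel_frontier \<tau>'. vertex_term T \<gamma> p - vertex_term T \<gamma>' p \<in> boundaries"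
proof -
  let ?P = "\<lambda>\<tau>'. p \<in> edge_space r m m' \<tau>' \<and>
    (\<forall>\<gamma>'\<in>rel_frontier \<tau>'. vertex_term T \<gamma> p - vertex_term T \<gamma>' p \<in> boundaries)"
  have step: "?P \<tau>2"
    if \<tau>12: "\<tau>1 \<in> interior_edges T" "\<tau>2 \<in> interior_edges T"
      and dir: "horizontal \<tau>1 \<longleftrightarrow> horizontal \<tau>" "horizontal \<tau>2 \<longleftrightarrow> horizontal \<tau>"
      and P: "?P \<tau>1" and ne: "\<tau>1 \<inter> \<tau>2 \<noteq> {}" for \<tau>1 \<tau>2
  proof (cases "\<tau>1 = \<tau>2")
    case False
    have E: "\<tau>1 \<in> edges T" "\<tau>2 \<in> edges T" using \<tau>12 interior_edges_subset by auto
    then obtain \<gamma>1 where \<gamma>1: "\<gamma>1 \<in> rel_frontier \<tau>1" "\<gamma>1 \<in> rel_frontier \<tau>2"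
      using ne edges_Int[OF T E False] by blast
    have p2: "p \<in> edge_space r m m' \<tau>2"
      using P edge_space_touching[OF edge_direction[OF T E(1)] edge_direction[OF T E(2)] _ ne] dir
      by simp
    have "vertex_term T \<gamma> p - vertex_term T \<gamma>' p \<in> boundaries" if "\<gamma>' \<in> rel_frontier \<tau>2" for \<gamma>'
      using boundaries_add[OF _ boundaries_edge[OF \<tau>12(2) p2 \<gamma>1(2) that], of "vertex_term T \<gamma> p - vertex_term T \<gamma>1 p"]
        P \<gamma>1(1) by simp
    with p2 show ?thesis by blast
  qed (use P in blast)
  have P0: "?P \<tau>" using p boundaries_edge[OF \<tau> p \<gamma>] by blast
  obtain \<tau>' where "\<tau>' \<in> interior_edges T" "?P \<tau>'" "x \<in> \<tau>'"
    by (rule maximal_segment_propagate[where P = ?P, OF T \<tau> P0 step x])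
  then show ?thesis using that by blast
qed

lemma boundaries_segment_vertices:
  assumes \<tau>: "\<tau> \<in> interior_edges T" and p: "p \<in> edge_space r m m' \<tau>"
    and \<gamma>: "\<gamma> \<in> vertices T" "\<gamma> \<in> \<rho> \<tau>" and \<gamma>': "\<gamma>' \<in> vertices T" "\<gamma>' \<in> \<rho> \<tau>"
  shows "vertex_term T \<gamma> p - vertex_term T \<gamma>' p \<in> boundaries"
proof -
  obtain \<gamma>0 where \<gamma>0: "\<gamma>0 \<in> rel_frontier \<tau>"
    using d \<tau> interior_edges_subset unfolding orientation_def by blast
  have *: "vertex_term T \<gamma>0 p - vertex_term T \<gamma> p \<in> boundaries"
    if v: "\<gamma> \<in> vertices T" "\<gamma> \<in> \<rho> \<tau>" for \<gamma>
  proof -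
    obtain \<tau>' where \<tau>': "\<tau>' \<in> interior_edges T" "\<gamma> \<in> \<tau>'"
      "\<forall>\<gamma>'\<in>rel_frontier \<tau>'. vertex_term T \<gamma>0 p - vertex_term T \<gamma>' p \<in> boundaries"
      by (rule boundaries_segment[OF \<tau> p \<gamma>0 v(2)])
    have "\<tau>' \<in> edges T" using \<tau>'(1) interior_edges_subset by blast
    from vertex_end_point[OF T this v(1) \<tau>'(2)] show ?thesis using \<tau>'(3) by blast
  qed
  show ?thesis using boundaries_diff[OF *[OF \<gamma>'] *[OF \<gamma>]] by simp
qed

text \<open>The term can be moved along the segment to a vertex outside the interior of the domain,
  where it is \<open>0\<close> by definition.\<close>

lemma boundaries_boundary_segment:
  assumes \<tau>: "\<tau> \<in> interior_edges T" and p: "p \<in> edge_space r m m' \<tau>"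
    and \<gamma>: "\<gamma> \<in> vertices T" "\<gamma> \<in> \<rho> \<tau>" and ne: "\<rho> \<tau> \<inter> frontier (domain T) \<noteq> {}"
  shows "vertex_term T \<gamma> p \<in> boundaries"
proof -
  obtain x where x: "x \<in> \<rho> \<tau>" "x \<notin> interior (domain T)" using ne by (auto simp: frontier_def)
  obtain S where S: "S \<subseteq> {\<tau>' \<in> interior_edges T. horizontal \<tau>' \<longleftrightarrow> horizontal \<tau>}" "\<rho> \<tau> = \<Union>S"
    by (rule maximal_segment_Union[OF T \<tau>])
  then obtain \<tau>' where \<tau>': "\<tau>' \<in> interior_edges T" "x \<in> \<tau>'" using x(1) by blast
  \<comment> \<open>Open interior edges lie in the interior of the domain, so \<open>x\<close> can
    only be an end point.\<close>
  have "x \<in> rel_frontier \<tau>'"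
    using interior_edge_subset_interior[OF T \<tau>'(1)] \<tau>'(2) x(2) by blast
  then have "x \<in> vertices T" using \<tau>'(1) interior_edges_subset by (auto simp: vertices_def)
  moreover have "vertex_term T x p = 0" using x(2) by (simp add: vertex_term_def interior_vertices_def)
  ultimately show ?thesis using boundaries_segment_vertices[OF \<tau> p \<gamma> _ x(1)] by simp
qed

section \<open>Induction on the ordering of the segments\<close>

lemma finite_vertices: "finite (vertices T)"
  unfolding vertices_def using finite_edges[OF T] finite_edge_frontier[OF edge_direction[OF T]] by blast

text \<open>Each piece \<open>g \<gamma>'\<close> vanishes modulo boundaries at its own vertex
  \<open>\<gamma>'\<close>, and can be moved from there to the common vertex
  \<open>\<gamma>\<close>.\<close>

lemma boundaries_decomposition:
  assumes \<tau>: "\<tau> \<in> interior_edges T" and p: "p \<in> edge_space r m m' \<tau>"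
    and \<gamma>: "\<gamma> \<in> vertices T" "\<gamma> \<in> \<rho> \<tau>"
    and G: "G \<subseteq> vertices T \<inter> \<rho> \<tau>" "p = sum g G"
    and g: "\<And>\<gamma>. \<gamma> \<in> G \<Longrightarrow> g \<gamma> \<in> edge_space r m m' \<tau>"
    and gW: "\<And>\<gamma>. \<gamma> \<in> G \<Longrightarrow> vertex_term T \<gamma> (g \<gamma>) \<in> boundaries"
  shows "vertex_term T \<gamma> p \<in> boundaries"
  unfolding G(2) vertex_term_sum
proof (rule boundaries_sum)
  fix \<gamma>' assume \<gamma>': "\<gamma>' \<in> G"
  then have "vertex_term T \<gamma> (g \<gamma>') - vertex_term T \<gamma>' (g \<gamma>') \<in> boundaries"
    using G(1) by (intro boundaries_segment_vertices[OF \<tau> g \<gamma>]) auto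
  from boundaries_add[OF this gW[OF \<gamma>']] show "vertex_term T \<gamma> (g \<gamma>') \<in> boundaries" by simp
qed

text \<open>The transversal segment either reaches the frontier or is a maximal interior segment. In
  the latter case it does not come later, because \<open>\<gamma>\<close> is free, and hence comes
  earlier by injectivity.\<close>

lemma boundaries_transversal:
  assumes "inj_on \<iota> (MIS T)"
    and \<tau>: "\<tau> \<in> interior_edges T" "\<rho> \<tau> \<in> MIS T" and \<gamma>: "\<gamma> \<in> free_vertices T \<iota> (\<rho> \<tau>)"
    and \<tau>': "\<tau>' \<in> edges T" "\<gamma> \<in> \<tau>'" "\<rho> \<tau>' \<noteq> \<rho> \<tau>" "\<gamma> \<in> interior (domain T)"
    and p: "p \<in> edge_space r m m' \<tau>'"
    and IH: "\<lbrakk>\<iota> (\<rho> \<tau>') < \<iota> (\<rho> \<tau>); \<tau>' \<in> interior_edges T; \<gamma> \<in> vertices T; \<gamma> \<in> \<rho> \<tau>'\<rbrakk> \<Longrightarrow>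
      vertex_term T \<gamma> p \<in> boundaries"
  shows "vertex_term T \<gamma> p \<in> boundaries"
proof -
  have i: "\<tau>' \<in> interior_edges T" using \<tau>' by (auto simp: interior_edges_def)
  have \<gamma>': "\<gamma> \<in> vertices T" "\<gamma> \<in> \<rho> \<tau>'"
    using \<gamma> \<tau>'(2) subset_maximal_segment[OF T i] by (auto simp: free_vertices_def)
  show ?thesis
  proof (cases "\<rho> \<tau>' \<inter> frontier (domain T) = {}")
    case True
    then have "\<rho> \<tau>' \<in> MIS T"
      using i interior_edge_direction[OF T i] by (auto simp: MIS_def MIS_h_def MIS_v_def)
    moreover from this have "\<not> \<iota> (\<rho> \<tau>) < \<iota> (\<rho> \<tau>')"
      using \<gamma> \<gamma>'(2) by (auto simp: free_vertices_def)
    ultimately have "\<iota> (\<rho> \<tau>') < \<iota> (\<rho> \<tau>)"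
      using assms(1) \<tau>(2) \<tau>'(3) by (metis inj_onD linorder_neqE_nat)
    from IH[OF this i \<gamma>'] show ?thesis .
  qed (rule boundaries_boundary_segment[OF i p \<gamma>'])
qed

lemma vertex_term_in_boundaries:
  assumes \<iota>: "inj_on \<iota> (MIS T)" and w: "weighted (m + 1) (m' + 1) T r m m' \<iota>"
    and "\<tau> \<in> interior_edges T" "p \<in> edge_space r m m' \<tau>" "\<gamma> \<in> vertices T" "\<gamma> \<in> \<rho> \<tau>"
  shows "vertex_term T \<gamma> p \<in> boundaries"
  using assms(3-)
\<comment> \<open>The hypothesis is only invoked for transversal segments that are interior; those
  reaching the frontier are settled directly, whatever value \<open>\<iota>\<close> has
  there.\<close>
proof (induction "\<iota> (\<rho> \<tau>)" arbitrary: \<tau> p \<gamma> rule: less_induct)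
  case less
  note \<tau> = less.prems(1)
  let ?G = "free_vertices T \<iota> (\<rho> \<tau>)"
  have G: "?G \<subseteq> vertices T \<inter> \<rho> \<tau>" by (auto simp: free_vertices_def)
  then have fin: "finite ?G" using finite_vertices by (meson finite_subset le_infE)
  show ?case
  proof (cases "\<rho> \<tau> \<inter> frontier (domain T) = {}")
    case False
    then show ?thesis using boundaries_boundary_segment less.prems by blast
  next
    case True
    then have MIS: "\<rho> \<tau> \<in> MIS T"
      using \<tau> interior_edge_direction[OF T \<tau>] by (auto simp: MIS_def MIS_h_def MIS_v_def)
    \<comment> \<open>This makes every edge through a free vertex an interior edge, with a maximal
      segment of its own.\<close>
    have int: "\<gamma> \<in> interior (domain T)" if "\<gamma> \<in> ?G" for \<gamma>
      using maximal_segment_subset_interior[OF T \<tau> True] that G by blast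
    obtain x where x: "x \<in> \<tau>" using edge_nonempty[OF interior_edge_direction[OF T \<tau>]] by blast
    show ?thesis
    proof (cases "horizontal \<tau>")
      case hor: True
      have snd: "snd \<gamma> = snd x" if "\<gamma> \<in> ?G" for \<gamma>
        using that G snd_maximal_segment[OF T \<tau> hor x] by blast
      \<comment> \<open>The vertical lines through the free vertices are distinct, as the
        decomposition requires.\<close>
      have inj: "inj_on fst ?G" by (intro inj_onI prod_eqI) (simp_all add: snd)
      have "\<rho> \<tau> \<in> MIS_h T" using \<tau> hor True by (auto simp: MIS_h_def)
      then have "int (m + 1) \<le> (\<Sum>\<gamma>\<in>?G. int m - int (fst r (fst \<gamma>)))"
        using w by (fastforce simp: weighted_def weight_def)
      note sum = less_sum_nat_of_int_weight[OF this]
      have "[:[:- snd x:], 1:] ^ (snd r (snd x) + 1) dvd p" "p \<in> bidegree_space m m'"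
        using less.prems(2) unfolding edge_space_horizontal[OF hor x] by auto
      from bipoly_sum_of_linear_powers_s[OF fin inj sum this(2,1)]
      obtain g where g: "\<And>\<gamma>. \<gamma> \<in> ?G \<Longrightarrow> g \<gamma> \<in> bidegree_space m m' \<and>
            [:[:- snd x:], 1:] ^ (snd r (snd x) + 1) dvd g \<gamma> \<and>
            [:[:- fst \<gamma>, 1:]:] ^ (fst r (fst \<gamma>) + 1) dvd g \<gamma>"
        and p: "p = sum g ?G" by blast
      show ?thesis
      proof (rule boundaries_decomposition[OF less.prems G p])
        fix \<gamma> assume \<gamma>: "\<gamma> \<in> ?G"
        show "g \<gamma> \<in> edge_space r m m' \<tau>"
          unfolding edge_space_horizontal[OF hor x] using g[OF \<gamma>] by blast
        have "\<gamma> \<in> vertices T" using \<gamma> G by blast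
        then have "\<exists>\<tau>'\<in>edges T. vertical \<tau>' \<and> \<gamma> \<in> \<tau>'" using T by (simp add: tmesh_def)
        then obtain \<tau>' where \<tau>': "\<tau>' \<in> edges T" "vertical \<tau>'" "\<gamma> \<in> \<tau>'" by blast
        have "\<tau>' \<in> interior_edges T" using \<tau>' int[OF \<gamma>] by (auto simp: interior_edges_def)
        then have "\<rho> \<tau>' \<noteq> \<rho> \<tau>" using maximal_segments_distinct[OF T \<tau> hor _ \<tau>'(2)] by metis
        moreover have "g \<gamma> \<in> edge_space r m m' \<tau>'"
          unfolding edge_space_vertical[OF \<tau>'(2,3)] using g[OF \<gamma>] by blast
        ultimately show "vertex_term T \<gamma> (g \<gamma>) \<in> boundaries"
          using boundaries_transversal[OF \<iota> \<tau> MIS \<gamma> \<tau>'(1,3) _ int[OF \<gamma>]] less.hyps by metis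
      qed
    next
      case False
      then have ver: "vertical \<tau>" using interior_edge_direction[OF T \<tau>] by blast
      have fst: "fst \<gamma> = fst x" if "\<gamma> \<in> ?G" for \<gamma>
        using that G fst_maximal_segment[OF T \<tau> ver x] by blast
      have inj: "inj_on snd ?G" by (intro inj_onI prod_eqI) (simp_all add: fst)
      have "\<rho> \<tau> \<in> MIS_v T" using \<tau> ver True by (auto simp: MIS_v_def)
      \<comment> \<open>Needed because \<open>weight\<close> tests for a horizontal segment
        first.\<close>
      moreover have "\<rho> \<tau> \<notin> MIS_h T"
        using maximal_segments_distinct[OF T _ _ \<tau> ver] by (auto simp: MIS_h_def)
      ultimately have "int (m' + 1) \<le> (\<Sum>\<gamma>\<in>?G. int m' - int (snd r (snd \<gamma>)))"
        using w by (fastforce simp: weighted_def weight_def)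
      note sum = less_sum_nat_of_int_weight[OF this]
      have "[:[:- fst x, 1:]:] ^ (fst r (fst x) + 1) dvd p" "p \<in> bidegree_space m m'"
        using less.prems(2) unfolding edge_space_vertical[OF ver x] by auto
      from bipoly_sum_of_linear_powers_t[OF fin inj sum this(2,1)]
      obtain g where g: "\<And>\<gamma>. \<gamma> \<in> ?G \<Longrightarrow> g \<gamma> \<in> bidegree_space m m' \<and>
            [:[:- fst x, 1:]:] ^ (fst r (fst x) + 1) dvd g \<gamma> \<and>
            [:[:- snd \<gamma>:], 1:] ^ (snd r (snd \<gamma>) + 1) dvd g \<gamma>"
        and p: "p = sum g ?G" by blast
      show ?thesis
      proof (rule boundaries_decomposition[OF less.prems G p])
        fix \<gamma> assume \<gamma>: "\<gamma> \<in> ?G"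
        show "g \<gamma> \<in> edge_space r m m' \<tau>"
          unfolding edge_space_vertical[OF ver x] using g[OF \<gamma>] by blast
        have "\<gamma> \<in> vertices T" using \<gamma> G by blast
        then have "\<exists>\<tau>'\<in>edges T. horizontal \<tau>' \<and> \<gamma> \<in> \<tau>'" using T by (simp add: tmesh_def)
        then obtain \<tau>' where \<tau>': "\<tau>' \<in> edges T" "horizontal \<tau>'" "\<gamma> \<in> \<tau>'" by blast
        have "\<tau>' \<in> interior_edges T" using \<tau>' int[OF \<gamma>] by (auto simp: interior_edges_def)
        then have "\<rho> \<tau>' \<noteq> \<rho> \<tau>" using maximal_segments_distinct[OF T _ \<tau>'(2) \<tau> ver] by metis
        moreover have "g \<gamma> \<in> edge_space r m m' \<tau>'"
          unfolding edge_space_horizontal[OF \<tau>'(2,3)] using g[OF \<gamma>] by blast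
        ultimately show "vertex_term T \<gamma> (g \<gamma>) \<in> boundaries"
          using boundaries_transversal[OF \<iota> \<tau> MIS \<gamma> \<tau>'(1,3) _ int[OF \<gamma>]] less.hyps by metis
      qed
    qed
  qed
qed

text \<open>A coefficient at an interior vertex is a sum of elements of the spaces of two edges
  through it. These edges are interior, so each summand is covered by
  \<open>vertex_term_in_boundaries\<close>.\<close>

lemma chains0_subset_boundaries:
  assumes "inj_on \<iota> (MIS T)" "weighted (m + 1) (m' + 1) T r m m' \<iota>"
  shows "chains0 T r m m' \<subseteq> boundaries"
proof
  fix c assume c: "c \<in> chains0 T r m m'"
  have "Poly_Mapping.single \<gamma> (Poly_Mapping.lookup c \<gamma>) \<in> boundaries" if "\<gamma> \<in> Poly_Mapping.keys c" for \<gamma>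
  proof -
    have \<gamma>: "\<gamma> \<in> interior_vertices T" using c that by (auto simp: chains0_def)
    then have v: "\<gamma> \<in> vertices T" "\<gamma> \<in> interior (domain T)" by (auto simp: interior_vertices_def)
    have *: "vertex_term T \<gamma> p \<in> boundaries"
      if "\<tau> \<in> edges T" "\<gamma> \<in> \<tau>" "p \<in> edge_space r m m' \<tau>" for \<tau> p
    proof -
      have \<tau>: "\<tau> \<in> interior_edges T" using that v(2) by (auto simp: interior_edges_def)
      show ?thesis
        using vertex_term_in_boundaries[OF assms \<tau> that(3) v(1)] subset_maximal_segment[OF T \<tau>] that(2)
        by blast
    qed
    have "Poly_Mapping.lookup c \<gamma> \<in> vertex_space T r m m' \<gamma>"
      using c \<gamma> by (simp add: chains0_def)
    then obtain p q \<tau>1 \<tau>2 where pq: "Poly_Mapping.lookup c \<gamma> = p + q"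
      "\<tau>1 \<in> edges T" "\<gamma> \<in> \<tau>1" "p \<in> edge_space r m m' \<tau>1"
      "\<tau>2 \<in> edges T" "\<gamma> \<in> \<tau>2" "q \<in> edge_space r m m' \<tau>2"
      unfolding vertex_space_def by blast
    have "vertex_term T \<gamma> (Poly_Mapping.lookup c \<gamma>) \<in> boundaries"
      unfolding pq(1) vertex_term_add by (intro boundaries_add *[OF pq(2-4)] *[OF pq(5-7)])
    then show ?thesis using \<gamma> by (simp add: vertex_term_def)
  qed
  then have "(\<Sum>\<gamma>\<in>Poly_Mapping.keys c. Poly_Mapping.single \<gamma> (Poly_Mapping.lookup c \<gamma>)) \<in> boundaries"
    by (rule boundaries_sum)
  then show "c \<in> boundaries" by (simp add: sum_single_lookup)
qed

end

theorem theorem3p9: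
  fixes T :: mesh and r :: smoothness and m m' :: nat
    and \<iota> :: "point set \<Rightarrow> nat" and d :: "point set \<Rightarrow> point \<times> point"
  assumes "tmesh T"
    and "orientation T d"
    and "inj_on \<iota> (MIS T)"
    and "weighted (m + 1) (m' + 1) T r m m' \<iota>"
  shows "h_number T r m m' d = 0"
proof -
  interpret oriented_tmesh T r m m' d by unfold_locales fact+
  show ?thesis
    using chains0_subset_boundaries[OF assms(3,4)] unfolding h_number_def boundaries_def
    by (rule chain.quotient_dim_eq_0)
qed

end
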